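(* Let $p$ be a prime, $d\ge 1$, and let $\phi:\mathbb{Q}_p^d\to\mathbb{Q}_p^d$ be a ${\rm mod}\,p$-affine isometry. Let $F$ be a complex valued function on the set ${\cal T}(\mathbb{Q}_p^d)$ of balls in $\mathbb{Q}_p^d$, let ${\bf k}:{\cal T}(\mathbb{Q}_p^d)\to\mathbb{F}_p^d\setminus\{0\}$, and let $D_{F(\cdot),{\bf k}(\cdot)}$ be the corresponding pseudodifferential vector field. Let $\Phi f(x)=f(\phi(x))$. Then $$ \Phi\circ D_{F(\cdot),{\bf k}(\cdot)}f(x)=D_{F(\phi(\cdot)),\,\phi^{-1}{\bf k}(\phi(\cdot))}\circ\Phi f(x) $$ for all $f:\mathbb{Q}_p^d\to\mathbb{C}$ and $x\in\mathbb{Q}_p^d$ for which the integrals and series defining both sides converge absolutely.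
   Context: On $\mathbb{Q}_p^d$ use the norm $|x|_p=\max_l|x_l|_p$. A ball is $B(a,p^{\gamma})=\{x:|x-a|_p\le p^{\gamma}\}$, $a\in\mathbb{Q}_p^d$, $\gamma\in\mathbb{Z}$, of diameter $p^{\gamma}$; ${\cal T}(\mathbb{Q}_p^d)$ is the set (tree) of all balls. $\mathbb{F}_p$ is the field of residues mod $p$. Mod $p$-affine isometries. For a ball $B$ of diameter $p^{\gamma}$ and a chosen point $x_B\in B$ let $T_B:B\to\mathbb{F}_p^d$, $T_B(x)=p^{\gamma}(x-x_B)\ {\rm mod}\ p\mathbb{Z}_p^d$ (here $p^\gamma\in\mathbb{Q}_p$); it identifies the maximal proper subballs of $B$ with elements of $\mathbb{F}_p^d$. For a bijective isometry $\phi$ of $\mathbb{Q}_p^d$ (which maps balls to balls) the tangent map at $B$ is the well-defined bijection $\phi_B=T_{\phi(B)}\circ\phi\circ T_B^{-1}:\mathbb{F}_p^d\to\mathbb{F}_p^d$; changing $x_B$, $x_{\phi(B)}$ changes it only by translations. A bijective isometry $\phi$ is called ${\rm mod}\,p$-affine if for every ball $B$ the map $\phi_B$ is affine over $\mathbb{F}_p$, i.e. a composition of a non-degenerate linear map and a translation. Denote by $A_B\in GL_d(\mathbb{F}_p)$ the linear part of $\phi_B$; it does not depend on the choices of $x_B$, $x_{\phi(B)}$. Pseudodifferential vector field. Given ${\bf k}$, for each ball $B$ choose vectors $k_1(B),\dots,k_d(B)\in\mathbb{Q}_p^d$ such that $|k_1(B)|_p=1$, $k_1(B)\ {\rm mod}\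 p={\bf k}(B)$, $|k_l(B)|_p=p^{-1}$ for $l=2,\dots,d$, and $\{k_1(B)\ {\rm mod}\ p,\,(p^{-1}k_2(B))\ {\rm mod}\ p,\dots,(p^{-1}k_d(B))\ {\rm mod}\ p\}$ generates $\mathbb{F}_p^d$. Then $$ D_{F(\cdot),{\bf k}(\cdot)}f(x)=\sum_{\gamma\in\mathbb{Z}}\ \int_{|z_1|_p=p^{\gamma},\ |z_l|_p\le p^{\gamma},\ l=2,\dots,d} F(B(x,p^{\gamma}))\Bigl[f(x)-f\Bigl(x+\sum_{l=1}^{d}z_l\,k_l(B(x,p^{\gamma}))\Bigr)\Bigr]dz_1\cdots dz_d , $$ where $dz_l$ is the Haar measure on $\mathbb{Q}_p$; the operator does not depend on the choice of the vectors $k_l(B)$ with the listed properties. Notation in the theorem: $F(\phi(\cdot))$ is the function $B\mapsto F(\phi(B))$, and $\phi^{-1}{\bf k}(\phi(\cdot))$ is the $\mathbb{F}_p^d\setminus\{0\}$-valued function $B\mapsto A_B^{-1}\,{\bf k}(\phi(B))$, i.e. the image of the vector ${\bf k}(\phi(B))$ attached to $\phi(B)$ under the linear part of the tangent map of $\phi^{-1}$ at $\phi(B)$. *)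

theory Defs
  imports "HOL-Analysis.Analysis" "HOL-Computational_Algebra.Fraction_Field"
    "Berlekamp_Zassenhaus.Finite_Field"
begin

section \<open>The field of p-adic numbers\<close>

text \<open>
  The prime is \<open>p = CARD('p)\<close> for a type \<open>'p\<close> of class \<^class>\<open>prime_card\<close>; the residue
  field is then \<open>'p mod_ring\<close>.  The ring of p-adic integers is the inverse limit of the rings
  of integers modulo \<open>p ^ n\<close> (with representatives in \<open>{0..<p ^ n}\<close>), and the p-adic numbers
  form its fraction field.
\<close>

typedef 'p padic_int =
  "{x :: nat \<Rightarrow> int. \<forall>n. x n = x (Suc n) mod int CARD('p::prime_card) ^ n}"
  morphisms padic_int_seq Abs_padic_int
  by (rule exI[of _ "\<lambda>_. 0"]) simp

setup_lifting type_definition_padic_int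

lemma padic_mod_Suc_mod:
  "((a :: int) mod int p ^ Suc n) mod int p ^ n = a mod int p ^ n"
  by (rule mod_mod_cancel) (simp add: le_imp_power_dvd)

lemma padic_coherent_ops:
  fixes a b a' b' q :: int
  assumes "a = a' mod q" "b = b' mod q"
  shows "(a + b) mod q = (a' + b') mod q" "(a * b) mod q = (a' * b') mod q"
    "(a - b) mod q = (a' - b') mod q" "(- a) mod q = (- a') mod q"
  unfolding assms by (simp_all add: mod_simps)

lemma padic_int_seq_Suc_mod:
  "padic_int_seq (x :: 'p::prime_card padic_int) (Suc n) mod int CARD('p) ^ n = padic_int_seq x n"
proof -
  have "\<forall>n. padic_int_seq x n = padic_int_seq x (Suc n) mod int CARD('p) ^ n"
    using padic_int_seq[of x] unfolding mem_Collect_eq .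
  then show ?thesis by metis
qed

lemma padic_int_seq_mod_self [simp]:
  "padic_int_seq (x :: 'p::prime_card padic_int) n mod int CARD('p) ^ n = padic_int_seq x n"
  by (metis padic_int_seq_Suc_mod mod_mod_trivial)

instantiation padic_int :: (prime_card) comm_ring_1
begin

lift_definition zero_padic_int :: "'a padic_int" is "\<lambda>_. 0" by simp

lift_definition one_padic_int :: "'a padic_int" is "\<lambda>n. 1 mod int CARD('a) ^ n"
  by (simp only: padic_mod_Suc_mod)

lift_definition plus_padic_int :: "'a padic_int \<Rightarrow> 'a padic_int \<Rightarrow> 'a padic_int"
  is "\<lambda>x y n. (x n + y n) mod int CARD('a) ^ n"
  by (unfold padic_mod_Suc_mod, blast intro: padic_coherent_ops(1))

lift_definition times_padic_int :: "'a padic_int \<Rightarrow> 'a padic_int \<Rightarrow> 'a padic_int"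
  is "\<lambda>x y n. (x n * y n) mod int CARD('a) ^ n"
  by (unfold padic_mod_Suc_mod, blast intro: padic_coherent_ops(2))

lift_definition minus_padic_int :: "'a padic_int \<Rightarrow> 'a padic_int \<Rightarrow> 'a padic_int"
  is "\<lambda>x y n. (x n - y n) mod int CARD('a) ^ n"
  by (unfold padic_mod_Suc_mod, blast intro: padic_coherent_ops(3))

lift_definition uminus_padic_int :: "'a padic_int \<Rightarrow> 'a padic_int"
  is "\<lambda>x n. (- x n) mod int CARD('a) ^ n"
  by (unfold padic_mod_Suc_mod, blast intro: padic_coherent_ops(4))

lemmas padic_int_seqs =
  zero_padic_int.rep_eq one_padic_int.rep_eq plus_padic_int.rep_eq times_padic_int.rep_eq
  minus_padic_int.rep_eq uminus_padic_int.rep_eq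

instance
proof
  fix a b c :: "'a padic_int"
  note [simp] = padic_int_seq_inject[symmetric] padic_int_seqs fun_eq_iff
  show "a * b * c = a * (b * c)" by (simp add: mod_simps algebra_simps)
  show "a * b = b * a" by (simp add: algebra_simps)
  show "1 * a = a" by (simp add: mod_simps)
  show "a + b + c = a + (b + c)" by (simp add: mod_simps algebra_simps)
  show "a + b = b + a" by (simp add: algebra_simps)
  show "0 + a = a" by simp
  show "- a + a = 0" by (simp add: mod_simps)
  show "a - b = a + - b" by (simp add: mod_simps)
  show "(a + b) * c = a * c + b * c" by (simp add: mod_simps algebra_simps)
  have "(1 :: int) < int CARD('a)"
    using prime_card[where 'a='a] prime_gt_1_nat by auto
  then show "(0 :: 'a padic_int) \<noteq> 1"
    by (auto intro!: exI[of _ 1])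
qed

end

definition padic_int_ord :: "'p::prime_card padic_int \<Rightarrow> nat" where
  "padic_int_ord x = (LEAST v. padic_int_seq x (Suc v) \<noteq> 0)"

lemma padic_int_seq_mod:
  fixes x :: "'p::prime_card padic_int"
  assumes "m \<le> n"
  shows "padic_int_seq x n mod int CARD('p) ^ m = padic_int_seq x m"
  using assms
proof (induction n rule: dec_induct)
  case base
  show ?case by simp
next
  case (step n)
  have "padic_int_seq x (Suc n) mod int CARD('p) ^ m =
    (padic_int_seq x (Suc n) mod int CARD('p) ^ n) mod int CARD('p) ^ m"
    by (rule mod_mod_cancel[symmetric]) (use step in \<open>simp add: le_imp_power_dvd\<close>)
  also have "padic_int_seq x (Suc n) mod int CARD('p) ^ n = padic_int_seq x n"
    by (rule padic_int_seq_Suc_mod)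
  finally show ?case using step by simp
qed

lemma padic_int_seq_0 [simp]: "padic_int_seq (x :: 'p::prime_card padic_int) 0 = 0"
  using padic_int_seq_mod[of 0 0 x] by simp

lemma padic_int_seq_eq_0_mono:
  "padic_int_seq (x :: 'p::prime_card padic_int) n = 0 \<Longrightarrow> m \<le> n \<Longrightarrow> padic_int_seq x m = 0"
  using padic_int_seq_mod[of m n x] by simp

lemma padic_int_eq_0_iff: "x = 0 \<longleftrightarrow> (\<forall>n. padic_int_seq x n = 0)"
  by (simp add: zero_padic_int.rep_eq fun_eq_iff flip: padic_int_seq_inject)

lemma padic_int_ord_props:
  fixes x :: "'p::prime_card padic_int"
  assumes "x \<noteq> 0"
  shows "padic_int_seq x n = 0 \<longleftrightarrow> n \<le> padic_int_ord x"
proof -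
  obtain k where "padic_int_seq x k \<noteq> 0" using assms padic_int_eq_0_iff by blast
  then obtain j where "padic_int_seq x (Suc j) \<noteq> 0" by (cases k) auto
  then have *: "padic_int_seq x (Suc (padic_int_ord x)) \<noteq> 0"
    unfolding padic_int_ord_def by (rule LeastI)
  have "padic_int_seq x (padic_int_ord x) = 0"
  proof (cases "padic_int_ord x")
    case (Suc v)
    then show ?thesis using not_less_Least[of v "\<lambda>v. padic_int_seq x (Suc v) \<noteq> 0"]
      by (simp add: padic_int_ord_def)
  qed simp
  then show ?thesis
    using * padic_int_seq_eq_0_mono by (metis not_less_eq_eq)
qed

lemma padic_int_factor:
  fixes x :: "'p::prime_card padic_int"
  assumes "x \<noteq> 0" "padic_int_ord x < n"
  obtains u where "padic_int_seq x n = int CARD('p) ^ padic_int_ord x * u" "\<not> int CARD('p) dvd u"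
proof -
  let ?v = "padic_int_ord x"
  have "padic_int_seq x n mod int CARD('p) ^ ?v = 0"
    using padic_int_seq_mod[of ?v n x] padic_int_ord_props[OF assms(1), of ?v] assms(2) by simp
  then obtain u where u: "padic_int_seq x n = int CARD('p) ^ ?v * u" by auto
  have "padic_int_seq x n mod int CARD('p) ^ Suc ?v \<noteq> 0"
    using padic_int_seq_mod[of "Suc ?v" n x] padic_int_ord_props[OF assms(1), of "Suc ?v"] assms(2)
    by simp
  then have "\<not> int CARD('p) dvd u" unfolding u by (auto simp: dvd_def)
  with u show ?thesis using that by blast
qed

lemma padic_int_mult_seq:
  "padic_int_seq (x * y :: 'p::prime_card padic_int) n =
     padic_int_seq x n * padic_int_seq y n mod int CARD('p) ^ n"
  by (simp add: padic_int_seqs)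

lemma padic_int_add_seq:
  "padic_int_seq (x + y :: 'p::prime_card padic_int) n =
     (padic_int_seq x n + padic_int_seq y n) mod int CARD('p) ^ n"
  by (simp add: padic_int_seqs)

lemma padic_int_mult_seq_neq_0:
  fixes x y :: "'p::prime_card padic_int"
  assumes "x \<noteq> 0" "y \<noteq> 0"
  shows "padic_int_seq (x * y) n = 0 \<longleftrightarrow> n \<le> padic_int_ord x + padic_int_ord y"
proof -
  let ?v = "padic_int_ord x" and ?w = "padic_int_ord y" and ?p = "int CARD('p)"
  let ?n = "Suc (?v + ?w)"
  obtain a where a: "padic_int_seq x ?n = ?p ^ ?v * a" "\<not> ?p dvd a"
    using padic_int_factor[OF assms(1), of ?n] by auto
  obtain b where b: "padic_int_seq y ?n = ?p ^ ?w * b" "\<not> ?p dvd b"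
    using padic_int_factor[OF assms(2), of ?n] by auto
  have ab: "\<not> ?p dvd a * b"
    using a b prime_card_int[where 'a='p] by (simp add: prime_dvd_mult_iff)
  have p0: "?p \<noteq> 0" by simp
  have prod: "padic_int_seq x ?n * padic_int_seq y ?n = ?p ^ (?v + ?w) * (a * b)"
    unfolding a b by (simp add: power_add)
  have "\<not> ?p ^ ?n dvd ?p ^ (?v + ?w) * (a * b)"
    using ab p0 by (metis dvd_mult_cancel_left power_Suc2 power_not_zero)
  then have "padic_int_seq (x * y) ?n \<noteq> 0"
    by (simp only: padic_int_mult_seq prod) (simp add: mod_eq_0_iff_dvd)
  moreover have "padic_int_seq (x * y) (?v + ?w) = 0"
  proof -
    have "padic_int_seq (x * y) (?v + ?w) = padic_int_seq (x * y) ?n mod ?p ^ (?v + ?w)"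
      by (rule padic_int_seq_mod[symmetric]) simp
    also have "\<dots> = (?p ^ (?v + ?w) * (a * b)) mod ?p ^ (?v + ?w)"
      unfolding padic_int_mult_seq prod by (rule padic_mod_Suc_mod)
    finally show ?thesis by simp
  qed
  ultimately show ?thesis
    using padic_int_seq_eq_0_mono by (metis not_less_eq_eq)
qed

instance padic_int :: (prime_card) idom
proof
  fix x y :: "'a padic_int"
  assume "x \<noteq> 0" "y \<noteq> 0"
  then show "x * y \<noteq> 0"
    using padic_int_mult_seq_neq_0[of x y "Suc (padic_int_ord x + padic_int_ord y)"]
    by (auto simp: padic_int_eq_0_iff)
qed

lemma padic_int_ord_mult:
  fixes x y :: "'p::prime_card padic_int"
  assumes "x \<noteq> 0" "y \<noteq> 0"
  shows "padic_int_ord (x * y) = padic_int_ord x + padic_int_ord y"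
  using padic_int_mult_seq_neq_0[OF assms] padic_int_ord_props[of "x * y"] assms
  by (metis antisym mult_eq_0_iff order_refl)

definition padic_int_abs :: "'p::prime_card padic_int \<Rightarrow> real" where
  "padic_int_abs x = (if x = 0 then 0 else real CARD('p) powi - int (padic_int_ord x))"

lemma padic_card_gt_1: "real CARD('p::prime_card) > 1"
  using prime_card[where 'a='p] prime_gt_1_nat by auto

lemma padic_int_abs_0 [simp]: "padic_int_abs 0 = 0"
  by (simp add: padic_int_abs_def)

lemma padic_int_abs_eq_0_iff [simp]: "padic_int_abs x = 0 \<longleftrightarrow> x = 0"
  by (simp add: padic_int_abs_def)

lemma padic_int_abs_nonneg [simp]: "padic_int_abs x \<ge> 0"
  by (simp add: padic_int_abs_def)

lemma padic_int_abs_mult: "padic_int_abs (x * y) = padic_int_abs x * padic_int_abs y"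
  by (auto simp: padic_int_abs_def padic_int_ord_mult power_int_diff power_int_minus field_simps
      simp flip: power_int_add)

lemma padic_int_abs_le_iff:
  fixes x :: "'p::prime_card padic_int"
  shows "padic_int_abs x \<le> real CARD('p) powi - int n \<longleftrightarrow> padic_int_seq x n = 0"
proof (cases "x = 0")
  case True
  then show ?thesis by (simp add: padic_int_eq_0_iff[THEN iffD1])
next
  case False
  let ?p = "real CARD('p)"
  have "?p powi - int (padic_int_ord x) \<le> ?p powi - int n \<longleftrightarrow> n \<le> padic_int_ord x"
    using power_int_increasing[of "- int (padic_int_ord x)" "- int n" ?p]
      power_int_strict_increasing[of "- int n" "- int (padic_int_ord x)" ?p]
      padic_card_gt_1[where 'p='p] by (cases "n \<le> padic_int_ord x") auto
  then show ?thesis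
    using False padic_int_ord_props[of x n] by (simp add: padic_int_abs_def)
qed

lemma padic_int_abs_add:
  fixes x y :: "'p::prime_card padic_int"
  shows "padic_int_abs (x + y) \<le> max (padic_int_abs x) (padic_int_abs y)"
proof -
  have main: "padic_int_abs (x + y) \<le> padic_int_abs x"
    if "padic_int_abs y \<le> padic_int_abs x" for x y :: "'p padic_int"
  proof (cases "x = 0")
    case True
    then show ?thesis using that by simp
  next
    case False
    have "padic_int_abs x = real CARD('p) powi - int (padic_int_ord x)"
      using False by (simp add: padic_int_abs_def)
    then show ?thesis
      using that padic_int_abs_le_iff[of x "padic_int_ord x"]
        padic_int_abs_le_iff[of y "padic_int_ord x"]
        padic_int_abs_le_iff[of "x + y" "padic_int_ord x"]
      by (simp add: padic_int_add_seq)
  qed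
  show ?thesis
    using main[of y x] main[of x y] by (cases "padic_int_abs y \<le> padic_int_abs x") (auto simp: add.commute)
qed

lemma padic_int_abs_uminus: "padic_int_abs (- x) = padic_int_abs x"
proof -
  let ?e = "padic_int_abs (1 :: 'a padic_int)" and ?m = "padic_int_abs (- 1 :: 'a padic_int)"
  have "?e * ?e = ?e"
    by (simp flip: padic_int_abs_mult)
  then have "?e = 1"
    by simp
  moreover have "?m * ?m = ?e"
    by (simp flip: padic_int_abs_mult)
  ultimately have "\<bar>?m\<bar> = 1"
    by (simp add: abs_square_eq_1 flip: power2_eq_square)
  then have "?m = 1"
    by simp
  then show ?thesis
    using padic_int_abs_mult[of "- 1" x] by simp
qed

text \<open>
  A type copy of the fraction field, so that it can carry its own metric, topology and
  Borel sigma-algebra.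
\<close>

typedef 'p padic = "UNIV :: 'p::prime_card padic_int fract set"
  morphisms fract_of_padic padic_of_fract ..

setup_lifting type_definition_padic

instantiation padic :: (prime_card) field
begin

lift_definition zero_padic :: "'a padic" is 0 .
lift_definition one_padic :: "'a padic" is 1 .
lift_definition plus_padic :: "'a padic \<Rightarrow> 'a padic \<Rightarrow> 'a padic" is "(+)" .
lift_definition times_padic :: "'a padic \<Rightarrow> 'a padic \<Rightarrow> 'a padic" is "(*)" .
lift_definition minus_padic :: "'a padic \<Rightarrow> 'a padic \<Rightarrow> 'a padic" is "(-)" .
lift_definition uminus_padic :: "'a padic \<Rightarrow> 'a padic" is uminus .
lift_definition inverse_padic :: "'a padic \<Rightarrow> 'a padic" is inverse .
lift_definition divide_padic :: "'a padic \<Rightarrow> 'a padic \<Rightarrow> 'a padic" is divide .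

instance
  by (standard; transfer) (auto simp: algebra_simps divide_inverse)

end

definition padic_of_int :: "'p::prime_card padic_int \<Rightarrow> 'p padic" where
  "padic_of_int a = padic_of_fract (Fract a 1)"

text \<open>The p-adic absolute value, normalised by \<open>padic_abs p = 1 / p\<close>.\<close>

definition fract_abs :: "'p::prime_card padic_int fract \<Rightarrow> real" where
  "fract_abs q = (THE r. \<exists>a b. b \<noteq> 0 \<and> q = Fract a b \<and> r = padic_int_abs a / padic_int_abs b)"

lemma fract_abs_Fract:
  assumes "b \<noteq> 0"
  shows "fract_abs (Fract a b) = padic_int_abs a / padic_int_abs b"
  unfolding fract_abs_def
proof (rule the_equality)
  fix r
  assume "\<exists>c d. d \<noteq> 0 \<and> Fract a b = Fract c d \<and> r = padic_int_abs c / padic_int_abs d"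
  then obtain c d where cd: "d \<noteq> 0" "Fract a b = Fract c d" "r = padic_int_abs c / padic_int_abs d"
    by blast
  then have "a * d = c * b" using assms by (simp add: eq_fract)
  then show "r = padic_int_abs a / padic_int_abs b"
    using assms cd by (simp add: frac_eq_eq flip: padic_int_abs_mult)
qed (use assms in blast)

lemma fract_abs_eq_0_iff: "fract_abs q = 0 \<longleftrightarrow> q = 0"
  by (cases q) (auto simp: fract_abs_Fract Zero_fract_def eq_fract)

lemma fract_abs_nonneg: "fract_abs q \<ge> 0"
  by (cases q) (auto simp: fract_abs_Fract)

lemma fract_abs_mult: "fract_abs (q * r) = fract_abs q * fract_abs r"
  by (cases q; cases r) (auto simp: fract_abs_Fract padic_int_abs_mult)

lemma fract_abs_uminus: "fract_abs (- q) = fract_abs q"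
  by (cases q) (auto simp: fract_abs_Fract padic_int_abs_uminus)

lemma fract_abs_add: "fract_abs (q + r) \<le> max (fract_abs q) (fract_abs r)"
proof (cases q; cases r)
  fix a b c d :: "'a padic_int"
  assume q: "q = Fract a b" "b \<noteq> 0" and r: "r = Fract c d" "d \<noteq> 0"
  let ?n = "padic_int_abs"
  have pos: "?n b > 0" "?n d > 0" using q r by (simp_all add: less_le)
  have "?n (a * d + c * b) / (?n b * ?n d) \<le> max (?n (a * d)) (?n (c * b)) / (?n b * ?n d)"
    using pos by (intro divide_right_mono padic_int_abs_add) auto
  also have "\<dots> = max (?n a / ?n b) (?n c / ?n d)"
    using pos by (auto simp: padic_int_abs_mult max_def field_simps)
  finally show ?thesis
    using q r by (simp add: fract_abs_Fract padic_int_abs_mult)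
qed

lift_definition padic_abs :: "'p::prime_card padic \<Rightarrow> real" is fract_abs .

lemma padic_abs_eq_0_iff [simp]: "padic_abs (x :: 'p::prime_card padic) = 0 \<longleftrightarrow> x = 0"
  by transfer (rule fract_abs_eq_0_iff)

lemma padic_abs_nonneg [simp]: "padic_abs (x :: 'p::prime_card padic) \<ge> 0"
  by transfer (rule fract_abs_nonneg)

lemma padic_abs_mult: "padic_abs (x * y :: 'p::prime_card padic) = padic_abs x * padic_abs y"
  by transfer (rule fract_abs_mult)

lemma padic_abs_uminus: "padic_abs (- x :: 'p::prime_card padic) = padic_abs x"
  by transfer (rule fract_abs_uminus)

lemma padic_abs_add: "padic_abs (x + y :: 'p::prime_card padic) \<le> max (padic_abs x) (padic_abs y)"
  by transfer (rule fract_abs_add)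

instantiation padic :: (prime_card) metric_space
begin

definition dist_padic :: "'a padic \<Rightarrow> 'a padic \<Rightarrow> real" where
  "dist_padic x y = padic_abs (x - y)"

definition uniformity_padic :: "('a padic \<times> 'a padic) filter" where
  "uniformity_padic = (INF e\<in>{0<..}. principal {(x, y). dist x y < e})"

definition open_padic :: "'a padic set \<Rightarrow> bool" where
  "open_padic U \<longleftrightarrow> (\<forall>x\<in>U. eventually (\<lambda>(x', y). x' = x \<longrightarrow> y \<in> U) uniformity)"

instance
proof
  fix x y z :: "'a padic"
  have "padic_abs (x - y) \<le> max (padic_abs (x - z)) (padic_abs (z - y))"
    using padic_abs_add[of "x - z" "z - y"] by simp
  also have "padic_abs (z - y) = padic_abs (y - z)"
    using padic_abs_uminus[of "y - z"] by simp
  also have "max (padic_abs (x - z)) (padic_abs (y - z)) \<le> padic_abs (x - z) + padic_abs (y - z)"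
    by simp
  finally show "dist x y \<le> dist x z + dist y z" by (simp add: dist_padic_def)
qed (simp_all add: dist_padic_def uniformity_padic_def open_padic_def)

end

text \<open>Normalised Haar measure on the additive group of p-adic numbers.\<close>

definition haar_measure :: "'p::prime_card padic measure \<Rightarrow> bool" where
  "haar_measure \<mu> \<longleftrightarrow>
     sets \<mu> = sets borel \<and>
     (\<forall>a. \<forall>A\<in>sets \<mu>. emeasure \<mu> ((\<lambda>x. a + x) ` A) = emeasure \<mu> A) \<and>
     emeasure \<mu> {x. padic_abs x \<le> 1} = 1"

abbreviation padic_p :: "'p::prime_card padic" where
  "padic_p \<equiv> of_nat CARD('p)"

text \<open>Reduction modulo p; only meaningful on p-adic integers, i.e. if \<open>padic_abs x \<le> 1\<close>.\<close>

definition padic_residue :: "'p::prime_card padic \<Rightarrow> 'p mod_ring" where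
  "padic_residue x = of_int (padic_int_seq (THE a. padic_of_int a = x) 1)"


section \<open>Balls and mod p-affine isometries\<close>

text \<open>
  The metric of the type \<^typ>\<open>'a ^ 'd\<close> in the library is the Euclidean one, so the
  maximum norm is introduced separately.
\<close>

definition vnorm :: "'p::prime_card padic ^ 'd \<Rightarrow> real" where
  "vnorm x = Max (range (\<lambda>l. padic_abs (x $ l)))"

definition vresidue :: "'p::prime_card padic ^ 'd \<Rightarrow> 'p mod_ring ^ 'd" where
  "vresidue x = (\<chi> l. padic_residue (x $ l))"

definition pball :: "'p::prime_card padic ^ 'd \<Rightarrow> int \<Rightarrow> ('p padic ^ 'd) set" where
  "pball a \<gamma> = {x. vnorm (x - a) \<le> real CARD('p) powi \<gamma>}"

definition balls :: "('p::prime_card padic ^ 'd) set set" where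
  "balls = {pball a \<gamma> | a \<gamma>. True}"

text \<open>The integer \<open>\<gamma>\<close> such that the ball has diameter \<open>p powi \<gamma>\<close>.\<close>

definition ball_exponent :: "('p::prime_card padic ^ 'd) set \<Rightarrow> int" where
  "ball_exponent B = (THE \<gamma>. \<exists>a. B = pball a \<gamma>)"

definition base_point :: "('p::prime_card padic ^ 'd) set \<Rightarrow> 'p padic ^ 'd" where
  "base_point B = (SOME x. x \<in> B)"

definition ball_coord ::
  "('p::prime_card padic ^ 'd) set \<Rightarrow> 'p padic ^ 'd \<Rightarrow> 'p mod_ring ^ 'd" where
  "ball_coord B x = vresidue (padic_p powi ball_exponent B *s (x - base_point B))"

definition bij_isometry :: "('p::prime_card padic ^ 'd \<Rightarrow> 'p padic ^ 'd) \<Rightarrow> bool" where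
  "bij_isometry \<phi> \<longleftrightarrow> bij \<phi> \<and> (\<forall>x y. vnorm (\<phi> x - \<phi> y) = vnorm (x - y))"

text \<open>
  The coordinate map of a ball is constant on its maximal proper subballs; composing with
  \<^const>\<open>inv_into\<close> picks a point of the subball, and the result does not depend on that point.
\<close>

definition tangent_map ::
  "('p::prime_card padic ^ 'd \<Rightarrow> 'p padic ^ 'd) \<Rightarrow> ('p padic ^ 'd) set \<Rightarrow>
     'p mod_ring ^ 'd \<Rightarrow> 'p mod_ring ^ 'd" where
  "tangent_map \<phi> B = ball_coord (\<phi> ` B) \<circ> \<phi> \<circ> inv_into B (ball_coord B)"

definition is_linear_part :: "'k::field ^ 'd ^ 'd \<Rightarrow> ('k ^ 'd \<Rightarrow> 'k ^ 'd) \<Rightarrow> bool" where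
  "is_linear_part A g \<longleftrightarrow> invertible A \<and> (\<exists>b. \<forall>v. g v = A *v v + b)"

definition mod_p_affine_isometry ::
  "('p::prime_card padic ^ 'd \<Rightarrow> 'p padic ^ 'd) \<Rightarrow> bool" where
  "mod_p_affine_isometry \<phi> \<longleftrightarrow>
     bij_isometry \<phi> \<and> (\<forall>B\<in>balls. \<exists>A. is_linear_part A (tangent_map \<phi> B))"

definition tangent_linear_part ::
  "('p::prime_card padic ^ 'd \<Rightarrow> 'p padic ^ 'd) \<Rightarrow> ('p padic ^ 'd) set \<Rightarrow>
     'p mod_ring ^ 'd ^ 'd" where
  "tangent_linear_part \<phi> B = (THE A. is_linear_part A (tangent_map \<phi> B))"


section \<open>Pseudodifferential vector fields\<close>

text \<open>
  The indices \<open>l = 1, \<dots>, d\<close> of the integration variables and of the vectors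
  \<open>k\<^sub>l(B)\<close> are the natural numbers from 1 to \<open>CARD('d)\<close>, because the index 1 plays a special
  role; \<open>K B l\<close> is the vector \<open>k\<^sub>l(B)\<close>.
\<close>

definition adapted_frame ::
  "(('p::prime_card padic ^ 'd) set \<Rightarrow> 'p mod_ring ^ 'd) \<Rightarrow>
     (('p padic ^ 'd) set \<Rightarrow> nat \<Rightarrow> 'p padic ^ 'd) \<Rightarrow> bool" where
  "adapted_frame k K \<longleftrightarrow> (\<forall>B\<in>balls.
     vnorm (K B 1) = 1 \<and> vresidue (K B 1) = k B \<and>
     (\<forall>l\<in>{2..CARD('d)}. vnorm (K B l) = real CARD('p) powi - 1) \<and>
     vec.span (insert (vresidue (K B 1))
       ((\<lambda>l. vresidue (padic_p powi - 1 *s K B l)) ` {2..CARD('d)})) = UNIV)"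

text \<open>
  The parameter \<open>\<mu>\<close> below is the Haar measure on the p-adic numbers, and \<open>n\<close> is the number
  of integration variables.
\<close>

definition product_haar :: "'p::prime_card padic measure \<Rightarrow> nat \<Rightarrow> (nat \<Rightarrow> 'p padic) measure" where
  "product_haar \<mu> n = Pi\<^sub>M {1..n} (\<lambda>_. \<mu>)"

definition integration_domain :: "nat \<Rightarrow> int \<Rightarrow> (nat \<Rightarrow> 'p::prime_card padic) set" where
  "integration_domain n \<gamma> = {z \<in> {1..n} \<rightarrow>\<^sub>E UNIV.
     padic_abs (z 1) = real CARD('p) powi \<gamma> \<and> (\<forall>l\<in>{2..n}. padic_abs (z l) \<le> real CARD('p) powi \<gamma>)}"

definition pd_integrand ::
  "(('p::prime_card padic ^ 'd) set \<Rightarrow> complex) \<Rightarrow>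
     (('p padic ^ 'd) set \<Rightarrow> nat \<Rightarrow> 'p padic ^ 'd) \<Rightarrow>
     ('p padic ^ 'd \<Rightarrow> complex) \<Rightarrow> 'p padic ^ 'd \<Rightarrow> int \<Rightarrow> (nat \<Rightarrow> 'p padic) \<Rightarrow> complex" where
  "pd_integrand F K f x \<gamma> z =
     F (pball x \<gamma>) * (f x - f (x + (\<Sum>l=1..CARD('d). z l *s K (pball x \<gamma>) l)))"

definition pd_integral ::
  "'p::prime_card padic measure \<Rightarrow> (('p padic ^ 'd) set \<Rightarrow> complex) \<Rightarrow>
     (('p padic ^ 'd) set \<Rightarrow> nat \<Rightarrow> 'p padic ^ 'd) \<Rightarrow>
     ('p padic ^ 'd \<Rightarrow> complex) \<Rightarrow> 'p padic ^ 'd \<Rightarrow> int \<Rightarrow> complex" where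
  "pd_integral \<mu> F K f x \<gamma> =
     (LINT z:integration_domain CARD('d) \<gamma>|product_haar \<mu> CARD('d). pd_integrand F K f x \<gamma> z)"

definition pd_vector_field ::
  "'p::prime_card padic measure \<Rightarrow> (('p padic ^ 'd) set \<Rightarrow> complex) \<Rightarrow>
     (('p padic ^ 'd) set \<Rightarrow> nat \<Rightarrow> 'p padic ^ 'd) \<Rightarrow>
     ('p padic ^ 'd \<Rightarrow> complex) \<Rightarrow> 'p padic ^ 'd \<Rightarrow> complex" where
  "pd_vector_field \<mu> F K f x = (\<Sum>\<^sub>\<infinity>\<gamma>\<in>UNIV. pd_integral \<mu> F K f x \<gamma>)"

definition pd_converges ::
  "'p::prime_card padic measure \<Rightarrow> (('p padic ^ 'd) set \<Rightarrow> complex) \<Rightarrow>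
     (('p padic ^ 'd) set \<Rightarrow> nat \<Rightarrow> 'p padic ^ 'd) \<Rightarrow>
     ('p padic ^ 'd \<Rightarrow> complex) \<Rightarrow> 'p padic ^ 'd \<Rightarrow> bool" where
  "pd_converges \<mu> F K f x \<longleftrightarrow>
     (\<forall>\<gamma>. set_integrable (product_haar \<mu> CARD('d)) (integration_domain CARD('d) \<gamma>)
            (pd_integrand F K f x \<gamma>)) \<and>
     (\<lambda>\<gamma>. norm (pd_integral \<mu> F K f x \<gamma>)) summable_on UNIV"

end

theory Submission
  imports Defs
begin

text \<open>
  The operators are series over the radii \<open>p\<^sup>\<gamma>\<close>, and the two series agree term by term.  Fix \<open>\<gamma>\<close>,
  put \<open>B = pball x \<gamma>\<close>, so that \<open>\<phi> ` B = pball (\<phi> x) \<gamma>\<close>, and let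
  \<open>M z = (\<Sum>l. z\<^sub>l k\<^sub>l)\<close> be the linear parametrisation given by the frame at \<open>\<phi> ` B\<close> and \<open>M'\<close> the one
  given by the frame at \<open>B\<close>.  The first integral samples \<open>f\<close> at \<open>\<phi> x + M z\<close> and the second at
  \<open>\<phi> (x + M' z)\<close>, so the substitution \<open>T z = inv M (\<phi> (x + M' z) - \<phi> x)\<close> turns one integrand into the
  other.  It remains to see that \<open>T\<close> preserves the Haar measure and the domain of integration.

  Measure: reducing modulo \<open>p\<close>, and using that the rescaled frame vectors form a basis of the
  residue space, one finds \<open>vnorm (M z) = max \<bar>z\<^sub>1\<bar> (max\<^sub>l \<bar>z\<^sub>l\<bar> / p)\<close>, where \<open>l \<ge> 2\<close>, for every
  frame (\<open>vnorm_frame_map_le_iff\<close>).  Hence \<open>T\<close> is an isometry for one fixed weighted maximum norm.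
  The balls of that norm are boxes, those of equal radius are translates of each other, and they
  generate the product sigma-algebra, so every surjective isometry of the weighted norm preserves the
  measure (\<open>distr_PiM_haar_isometry\<close>).

  Domain: again by reduction modulo \<open>p\<close>, \<open>M\<close> maps the domain of integration onto the vectors \<open>y\<close> with
  \<open>vnorm y \<le> p\<^sup>\<gamma>\<close> for which \<open>p\<^sup>\<gamma> y\<close> reduces to a nonzero multiple of the direction attached to
  \<open>\<phi> ` B\<close> (\<open>integration_domain_iff\<close>), and likewise for \<open>M'\<close> and \<open>B\<close>.  On reductions, the increment
  map \<open>y \<mapsto> \<phi> (x + y) - \<phi> x\<close> acts as the linear part of the tangent map
  (\<open>mod_p_affine_isometry_increment\<close>), which carries the direction at \<open>B\<close> to the one at \<open>\<phi> ` B\<close>;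
  so \<open>T\<close> respects the two domains.
\<close>

section \<open>The ring of p-adic integers is the closed unit ball\<close>

text \<open>
  This makes the fraction field description concrete: a fraction of absolute value at most 1 is an
  integer.  Write \<open>v\<close> for the order of \<open>b\<close>.  The quotient is found one precision at a time, its class
  modulo \<open>p ^ n\<close> being the unique solution of \<open>b * c = a\<close> modulo \<open>p ^ (n + v)\<close>; uniqueness makes
  the solutions coherent.
\<close>

lemma padic_int_dvd_if_abs_le:
  fixes a b :: "'p::prime_card padic_int"
  assumes b: "b \<noteq> 0" and le: "padic_int_abs a \<le> padic_int_abs b"
  shows "\<exists>c. a = b * c"
proof -
  define p where "p = int CARD('p)"
  define v where "v = padic_int_ord b"
  \<comment> \<open>One digit more than \<open>n + v\<close>, so that even for \<open>n = 0\<close> it shows \<open>b\<close> as \<open>p ^ v\<close> times a unit.\<close>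
  define N where "N n = Suc (n + v)" for n
  define R where "R n c \<longleftrightarrow> p ^ (n + v) dvd padic_int_seq b (N n) * c - padic_int_seq a (N n)" for n c
  have p: "prime p" "p > 1" "p \<noteq> 0"
    using prime_card_int[where 'a='p] prime_gt_1_int[of p] by (auto simp: p_def)
  have "padic_int_abs b = real CARD('p) powi - int v"
    using b by (simp add: padic_int_abs_def v_def)
  then have av: "padic_int_seq a v = 0"
    using le padic_int_abs_le_iff[of a v] by simp
  have fact: "\<exists>\<beta> \<alpha>. padic_int_seq b (N n) = p ^ v * \<beta> \<and> coprime \<beta> (p ^ n) \<and>
      padic_int_seq a (N n) = p ^ v * \<alpha>" for n
  proof -
    obtain \<beta> where \<beta>: "padic_int_seq b (N n) = p ^ v * \<beta>" "\<not> p dvd \<beta>"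
      using padic_int_factor[OF b, of "N n"] by (auto simp: N_def v_def p_def)
    have "coprime \<beta> p" using \<beta>(2) p(1) by (metis coprime_commute prime_imp_coprime)
    moreover have "padic_int_seq a (N n) mod p ^ v = 0"
      using padic_int_seq_mod[of v "N n" a] av by (simp add: N_def p_def)
    then obtain \<alpha> where "padic_int_seq a (N n) = p ^ v * \<alpha>" by auto
    ultimately show ?thesis using \<beta> by auto
  qed
  have ex: "\<exists>c. R n c \<and> c mod p ^ n = c" for n
  proof -
    obtain \<beta> \<alpha> where f: "padic_int_seq b (N n) = p ^ v * \<beta>" "coprime \<beta> (p ^ n)"
      "padic_int_seq a (N n) = p ^ v * \<alpha>" using fact by blast
    obtain t where "[\<beta> * t = 1] (mod p ^ n)" using cong_solve_coprime_int[OF f(2)] by blast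
    then have "[\<beta> * t * \<alpha> = 1 * \<alpha>] (mod p ^ n)" by (rule cong_scalar_right)
    then have "[\<beta> * ((t * \<alpha>) mod p ^ n) = \<alpha>] (mod p ^ n)"
      by (simp add: cong_def mod_simps mult.assoc)
    then have "p ^ n dvd \<beta> * ((t * \<alpha>) mod p ^ n) - \<alpha>" by (simp add: cong_iff_dvd_diff)
    then have "p ^ v * p ^ n dvd p ^ v * (\<beta> * ((t * \<alpha>) mod p ^ n) - \<alpha>)" by simp
    then have "R n ((t * \<alpha>) mod p ^ n)"
      unfolding R_def f by (simp add: power_add algebra_simps)
    then show ?thesis by (intro exI[of _ "(t * \<alpha>) mod p ^ n"]) simp
  qed
  have uniq: "c = c'" if "R n c" "R n c'" "c mod p ^ n = c" "c' mod p ^ n = c'" for n c c'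
  proof -
    obtain \<beta> \<alpha> where f: "padic_int_seq b (N n) = p ^ v * \<beta>" "coprime \<beta> (p ^ n)"
      "padic_int_seq a (N n) = p ^ v * \<alpha>" using fact by blast
    have "p ^ (n + v) dvd (p ^ v * \<beta> * c - p ^ v * \<alpha>) - (p ^ v * \<beta> * c' - p ^ v * \<alpha>)"
      using that(1,2) unfolding R_def f by (rule dvd_diff)
    then have "p ^ v * p ^ n dvd p ^ v * (\<beta> * (c - c'))"
      by (simp add: power_add algebra_simps)
    then have "p ^ n dvd \<beta> * (c - c')" using p(3) by simp
    then have "p ^ n dvd c - c'" using f(2) by (simp add: coprime_commute coprime_dvd_mult_right_iff)
    then show ?thesis using that(3,4) by (metis mod_eq_dvd_iff)
  qed
  obtain c where c: "\<And>n. R n (c n)" "\<And>n. c n mod p ^ n = c n" using ex by metis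
  have coherent: "c n = c (Suc n) mod p ^ n" for n
  proof (rule uniq[of n])
    obtain \<beta> \<alpha> where f: "padic_int_seq b (N n) = p ^ v * \<beta>" "coprime \<beta> (p ^ n)"
      "padic_int_seq a (N n) = p ^ v * \<alpha>" using fact by blast
    have N: "N (Suc n) = Suc (N n)" by (simp add: N_def)
    have d1: "p ^ (n + v) dvd padic_int_seq y (Suc (N n)) - padic_int_seq y (N n)"
      for y :: "'p padic_int"
    proof -
      have "p ^ N n dvd padic_int_seq y (Suc (N n)) - padic_int_seq y (N n)"
        using padic_int_seq_Suc_mod[of y "N n"] by (simp add: p_def mod_eq_dvd_iff[symmetric])
      then show ?thesis by (rule dvd_trans[rotated]) (simp add: N_def le_imp_power_dvd)
    qed
    have d2: "p ^ (n + v) dvd padic_int_seq b (Suc (N n)) * c (Suc n) - padic_int_seq a (Suc (N n))"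
      using c(1)[of "Suc n"] unfolding R_def N by (rule dvd_trans[rotated]) (simp add: le_imp_power_dvd)
    have d3: "p ^ (n + v) dvd padic_int_seq b (N n) * (c (Suc n) - c (Suc n) mod p ^ n)"
    proof -
      have "p ^ n dvd c (Suc n) - c (Suc n) mod p ^ n" by (simp add: minus_mod_eq_mult_div)
      then show ?thesis unfolding f(1) by (metis add.commute dvd_triv_left mult_dvd_mono power_add)
    qed
    have telescope: "X * C' - Y = (Z * C - W) - (Z - X) * C + (W - Y) - X * (C - C')"
      for X Y Z W C C' :: int by (simp add: algebra_simps)
    have "padic_int_seq b (N n) * (c (Suc n) mod p ^ n) - padic_int_seq a (N n) =
      (padic_int_seq b (Suc (N n)) * c (Suc n) - padic_int_seq a (Suc (N n)))
      - (padic_int_seq b (Suc (N n)) - padic_int_seq b (N n)) * c (Suc n)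
      + (padic_int_seq a (Suc (N n)) - padic_int_seq a (N n))
      - padic_int_seq b (N n) * (c (Suc n) - c (Suc n) mod p ^ n)"
      by (rule telescope)
    then show "R n (c (Suc n) mod p ^ n)"
      unfolding R_def by (simp only: dvd_diff dvd_add dvd_mult2 d1 d2 d3)
  qed (simp_all only: c mod_mod_trivial)
  have seq: "padic_int_seq (Abs_padic_int c :: 'p padic_int) = c"
    by (rule Abs_padic_int_inverse, rule CollectI, rule allI, rule coherent[unfolded p_def])
  have "a = b * Abs_padic_int c"
  proof -
    have "padic_int_seq a n = padic_int_seq b n * c n mod p ^ n" for n
    proof -
      have "p ^ n dvd padic_int_seq b (N n) * c n - padic_int_seq a (N n)"
        using c(1)[of n] unfolding R_def by (rule dvd_trans[rotated]) (simp add: le_imp_power_dvd)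
      then have "padic_int_seq a (N n) mod p ^ n = padic_int_seq b (N n) * c n mod p ^ n"
        by (metis mod_eq_dvd_iff)
      also have "\<dots> = (padic_int_seq b (N n) mod p ^ n) * c n mod p ^ n" by (simp add: mod_simps)
      finally show ?thesis
        using padic_int_seq_mod[of n "N n" a] padic_int_seq_mod[of n "N n" b]
        by (simp add: N_def p_def)
    qed
    then have "padic_int_seq a = padic_int_seq (b * Abs_padic_int c)"
      by (auto simp: fun_eq_iff padic_int_mult_seq seq p_def)
    then show ?thesis by (simp add: padic_int_seq_inject)
  qed
  then show ?thesis by blast
qed

lemma padic_int_seq_of_nat: "padic_int_seq (of_nat m :: 'p::prime_card padic_int) n = int m mod int CARD('p) ^ n"
  by (induction m) (simp_all add: padic_int_seqs mod_simps)

lemma padic_int_seq_of_int: "padic_int_seq (of_int m :: 'p::prime_card padic_int) n = m mod int CARD('p) ^ n"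
  by (cases m rule: int_cases2) (simp_all add: padic_int_seqs padic_int_seq_of_nat mod_simps)

lemma padic_of_int_simps [simp]:
  "padic_of_int 0 = 0" "padic_of_int 1 = 1"
  "padic_of_int (a + b) = padic_of_int a + padic_of_int b"
  "padic_of_int (a * b) = padic_of_int a * padic_of_int b"
  "padic_of_int (- a) = - padic_of_int a"
  "padic_of_int (a - b) = padic_of_int a - padic_of_int b"
  by (simp_all add: padic_of_int_def zero_padic_def one_padic_def Zero_fract_def One_fract_def
      plus_padic.abs_eq times_padic.abs_eq uminus_padic.abs_eq minus_padic.abs_eq eq_onp_def)

lemma padic_of_int_of_nat [simp]: "padic_of_int (of_nat n) = of_nat n"
  by (induction n) simp_all

lemma padic_of_int_of_int [simp]: "padic_of_int (of_int n) = of_int n"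
  by (cases n rule: int_cases2) simp_all

lemma padic_of_int_inject [simp]: "padic_of_int a = padic_of_int b \<longleftrightarrow> a = b"
  by (simp add: padic_of_int_def padic_of_fract_inject eq_fract)

lemma padic_int_abs_one [simp]: "padic_int_abs (1 :: 'p::prime_card padic_int) = 1"
proof -
  have "padic_int_abs (1 :: 'p padic_int) * padic_int_abs (1 :: 'p padic_int) = padic_int_abs (1 :: 'p padic_int)"
    by (simp flip: padic_int_abs_mult)
  then show ?thesis by simp
qed

lemma padic_abs_of_int [simp]: "padic_abs (padic_of_int a) = padic_int_abs a"
  by (simp add: padic_of_int_def padic_abs.abs_eq fract_abs_Fract)

lemma padic_abs_0 [simp]: "padic_abs 0 = 0" by simp

lemma padic_abs_le_1_iff: "padic_abs x \<le> 1 \<longleftrightarrow> x \<in> range padic_of_int"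
proof
  assume x: "padic_abs x \<le> 1"
  obtain a b where ab: "fract_of_padic x = Fract a b" "b \<noteq> 0" by (cases "fract_of_padic x")
  then have x_eq: "x = padic_of_fract (Fract a b)" by (metis fract_of_padic_inverse)
  have "padic_int_abs b > 0" using ab(2) by (simp add: less_le)
  then have "padic_int_abs a \<le> padic_int_abs b"
    using x ab(2) by (simp add: x_eq padic_abs.abs_eq fract_abs_Fract)
  then obtain c where "a = b * c" using padic_int_dvd_if_abs_le ab(2) by blast
  then have "x = padic_of_int c" using ab(2) by (simp add: x_eq padic_of_int_def padic_of_fract_inject eq_fract)
  then show "x \<in> range padic_of_int" by simp
next
  assume "x \<in> range padic_of_int"
  then obtain a where "x = padic_of_int a" by blast
  then show "padic_abs x \<le> 1" using padic_int_abs_le_iff[of a 0] by simp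
qed

lemma padic_abs_p [simp]: "padic_abs (padic_p :: 'p::prime_card padic) = 1 / real CARD('p)"
proof -
  let ?p = "of_nat CARD('p) :: 'p padic_int"
  have gt: "int CARD('p) > 1" using prime_card_int[where 'a='p] prime_gt_1_int by blast
  have s1: "padic_int_seq ?p 1 = 0" and s2: "padic_int_seq ?p 2 \<noteq> 0"
    using gt by (simp_all add: padic_int_seq_of_nat power2_eq_square)
  then have nz: "?p \<noteq> 0" by (auto simp: padic_int_eq_0_iff)
  then have "padic_int_ord ?p = 1"
    using padic_int_ord_props[OF nz, of 1] padic_int_ord_props[OF nz, of 2] s1 s2 by simp
  then have "padic_int_abs ?p = 1 / real CARD('p)"
    using nz by (simp add: padic_int_abs_def power_int_minus divide_inverse)
  then show ?thesis by (metis padic_abs_of_int padic_of_int_of_nat)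
qed

section \<open>Calculus of the absolute value\<close>

lemma power_int_le_cancel:
  fixes q :: real assumes "q > 1"
  shows "q powi a \<le> q powi b \<longleftrightarrow> a \<le> b"
  using power_int_increasing[of a b q] power_int_strict_increasing[of b a q] assms
  by (cases "a \<le> b") auto

lemma power_int_less_cancel:
  fixes q :: real assumes "q > 1"
  shows "q powi a < q powi b \<longleftrightarrow> a < b"
  using power_int_le_cancel[OF assms, of b a] by linarith

lemmas padic_powi_le_cancel = power_int_le_cancel[OF padic_card_gt_1]
lemmas padic_powi_less_cancel = power_int_less_cancel[OF padic_card_gt_1]

lemma padic_abs_1 [simp]: "padic_abs (1 :: 'p::prime_card padic) = 1"
  using padic_abs_of_int[of "1 :: 'p padic_int"] by simp

lemma padic_abs_power: "padic_abs (x ^ n) = padic_abs x ^ n"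
  by (induction n) (simp_all add: padic_abs_mult)

lemma padic_abs_inverse: "padic_abs (inverse x) = inverse (padic_abs x)"
proof (cases "x = 0")
  case False
  then have "padic_abs x * padic_abs (inverse x) = 1" by (simp flip: padic_abs_mult)
  then show ?thesis by (metis inverse_unique)
qed simp

lemma padic_abs_power_int: "padic_abs (x powi n) = padic_abs x powi n"
  by (simp add: power_int_def padic_abs_power padic_abs_inverse)

lemma padic_p_neq_0 [simp]: "(padic_p :: 'p::prime_card padic) \<noteq> 0"
  using padic_abs_p[where 'p='p] padic_card_gt_1[where 'p='p] by (metis divide_eq_0_iff less_numeral_extra(4) not_one_less_zero padic_abs_0 zero_neq_one)

lemma padic_abs_p_powi [simp]: "padic_abs (padic_p powi n :: 'p::prime_card padic) = real CARD('p) powi (- n)"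
  by (simp add: padic_abs_power_int power_int_minus power_int_divide_distrib divide_inverse power_int_inverse)

lemma padic_abs_values:
  assumes "(x :: 'p::prime_card padic) \<noteq> 0"
  obtains n where "padic_abs x = real CARD('p) powi n"
proof -
  obtain a b where ab: "fract_of_padic x = Fract a b" "b \<noteq> 0" by (cases "fract_of_padic x")
  then have x_eq: "x = padic_of_fract (Fract a b)" by (metis fract_of_padic_inverse)
  have abs: "padic_abs x = padic_int_abs a / padic_int_abs b"
    using ab(2) by (simp add: x_eq padic_abs.abs_eq fract_abs_Fract)
  with assms have "a \<noteq> 0" by (metis div_0 padic_abs_eq_0_iff padic_int_abs_0)
  then have "padic_abs x = real CARD('p) powi (int (padic_int_ord b) - int (padic_int_ord a))"
    using ab(2) by (simp add: abs padic_int_abs_def power_int_minus power_int_diff divide_inverse mult.commute)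
  then show ?thesis using that by blast
qed

text \<open>
  The absolute value only takes powers of \<open>p\<close> as nonzero values, so strict bounds can be
  replaced by weak ones with the next smaller exponent.
\<close>

lemma padic_abs_less_iff:
  "padic_abs (x :: 'p::prime_card padic) < real CARD('p) powi n \<longleftrightarrow> padic_abs x \<le> real CARD('p) powi (n - 1)"
proof (cases "x = 0")
  case True
  then show ?thesis using padic_card_gt_1[where 'p='p] by simp
next
  case False
  then obtain m where "padic_abs x = real CARD('p) powi m" using padic_abs_values by blast
  then show ?thesis by (simp add: padic_powi_le_cancel padic_powi_less_cancel)
qed

lemma padic_abs_scale_le_iff:
  "padic_abs (padic_p powi a * x :: 'p::prime_card padic) \<le> real CARD('p) powi b
    \<longleftrightarrow> padic_abs x \<le> real CARD('p) powi (a + b)"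
proof -
  have "real CARD('p) powi a > 0" using padic_card_gt_1[where 'p='p] by simp
  then show ?thesis using padic_card_gt_1[where 'p='p]
    by (simp add: padic_abs_mult power_int_minus power_int_add field_simps)
qed

lemma padic_abs_add_le:
  "padic_abs x \<le> r \<Longrightarrow> padic_abs y \<le> r \<Longrightarrow> padic_abs (x + y :: 'p::prime_card padic) \<le> r"
  using padic_abs_add[of x y] by simp

lemma padic_abs_diff_le:
  "padic_abs x \<le> r \<Longrightarrow> padic_abs y \<le> r \<Longrightarrow> padic_abs (x - y :: 'p::prime_card padic) \<le> r"
  using padic_abs_add_le[of x r "- y"] by (simp add: padic_abs_uminus)

section \<open>Reduction modulo p\<close>

lemma of_int_mod_ring_mod: "(of_int (m mod int CARD('p)) :: 'p::prime_card mod_ring) = of_int m"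
  using of_int_mod_CHAR[where 'a="'p mod_ring", of m] by simp

lemma padic_residue_of_int: "padic_residue (padic_of_int a :: 'p::prime_card padic) = of_int (padic_int_seq a 1)"
  by (simp add: padic_residue_def)

lemma padic_residue_add:
  assumes "padic_abs x \<le> 1" "padic_abs y \<le> 1"
  shows "padic_residue (x + y :: 'p::prime_card padic) = padic_residue x + padic_residue y"
proof -
  obtain a b where [simp]: "x = padic_of_int a" "y = padic_of_int b"
    using assms padic_abs_le_1_iff by blast
  have "padic_residue (padic_of_int (a + b) :: 'p padic) = padic_residue x + padic_residue y"
    unfolding padic_residue_of_int by (simp add: padic_residue_of_int padic_int_add_seq of_int_mod_ring_mod)
  then show ?thesis by simp
qed

lemma padic_residue_mult:
  assumes "padic_abs x \<le> 1" "padic_abs y \<le> 1"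
  shows "padic_residue (x * y :: 'p::prime_card padic) = padic_residue x * padic_residue y"
proof -
  obtain a b where [simp]: "x = padic_of_int a" "y = padic_of_int b"
    using assms padic_abs_le_1_iff by blast
  have "padic_residue (padic_of_int (a * b) :: 'p padic) = padic_residue x * padic_residue y"
    unfolding padic_residue_of_int by (simp add: padic_residue_of_int padic_int_mult_seq of_int_mod_ring_mod)
  then show ?thesis by simp
qed

lemma padic_residue_eq_0_iff:
  assumes "padic_abs x \<le> 1"
  shows "padic_residue (x :: 'p::prime_card padic) = 0 \<longleftrightarrow> padic_abs x \<le> real CARD('p) powi - 1"
proof -
  obtain a where [simp]: "x = padic_of_int a" using assms padic_abs_le_1_iff by blast
  have "padic_residue x = 0 \<longleftrightarrow> int CARD('p) dvd padic_int_seq a 1"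
    using of_int_eq_0_iff_char_dvd[where 'a="'p mod_ring"] by (simp add: padic_residue_of_int)
  also have "\<dots> \<longleftrightarrow> padic_int_seq a 1 = 0"
    using padic_int_seq_mod_self[of a 1] by (simp add: dvd_eq_mod_eq_0)
  finally show ?thesis using padic_int_abs_le_iff[of a 1] by simp
qed

lemma padic_residue_0 [simp]: "padic_residue (0 :: 'p::prime_card padic) = 0"
  by (subst padic_residue_eq_0_iff) simp_all

lemma padic_residue_sum:
  assumes "\<And>i. i \<in> I \<Longrightarrow> padic_abs (x i) \<le> 1"
  shows "padic_residue (\<Sum>i\<in>I. x i :: 'p::prime_card padic) = (\<Sum>i\<in>I. padic_residue (x i))
    \<and> padic_abs (\<Sum>i\<in>I. x i) \<le> 1"
  using assms
  by (induction I rule: infinite_finite_induct) (simp_all add: padic_residue_add padic_abs_add_le)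

section \<open>Separability and the maximum norm\<close>

text \<open>
  Truncating a p-adic expansion leaves an element of \<open>\<int>[1/p]\<close>.  The countable set of these elements
  later supplies the centres of countable covers by balls of any given radius.
\<close>

lemma padic_countable_dense:
  "\<exists>Q :: 'p::prime_card padic set. countable Q \<and>
     (\<forall>x \<gamma>. \<exists>q\<in>Q. padic_abs (x - q) \<le> real CARD('p) powi \<gamma>)"
proof (intro exI conjI allI)
  let ?Q = "range (\<lambda>(j :: int, n :: int). padic_p powi n * of_int j :: 'p padic)"
  show "countable ?Q" by simp
  fix x :: "'p padic" and \<gamma>
  obtain n where n: "padic_abs x \<le> real CARD('p) powi n"
  proof (cases "x = 0")
    case True
    then show ?thesis using that[of 0] by simp
  next
    case False
    then obtain n where "padic_abs x = real CARD('p) powi n" by (rule padic_abs_values)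
    then show ?thesis using that[of n] by simp
  qed
  then have "padic_abs (padic_p powi n * x) \<le> 1"
    using padic_abs_scale_le_iff[of n x 0] by simp
  then obtain a where a: "padic_p powi n * x = padic_of_int a" using padic_abs_le_1_iff by blast
  define m where "m = nat (n - \<gamma>)"
  define j where "j = padic_int_seq a m"
  have "padic_int_seq (a - of_int j) m = 0"
    by (simp add: minus_padic_int.rep_eq padic_int_seq_of_int j_def)
  then have "padic_abs (padic_of_int (a - of_int j) :: 'p padic) \<le> real CARD('p) powi - int m"
    unfolding padic_abs_of_int padic_int_abs_le_iff .
  moreover have "x - padic_p powi - n * of_int j = padic_p powi - n * padic_of_int (a - of_int j)"
    by (simp add: right_diff_distrib power_int_minus field_simps flip: a)
  ultimately have "padic_abs (x - padic_p powi - n * of_int j) \<le> real CARD('p) powi (n - int m)"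
    by (simp add: padic_abs_scale_le_iff)
  also have "\<dots> \<le> real CARD('p) powi \<gamma>" by (simp add: padic_powi_le_cancel m_def)
  finally show "\<exists>q\<in>?Q. padic_abs (x - q) \<le> real CARD('p) powi \<gamma>" by force
qed

lemma vnorm_le_iff: "vnorm x \<le> r \<longleftrightarrow> (\<forall>l. padic_abs (x $ l) \<le> r)"
  by (auto simp: vnorm_def)

lemma vnorm_diff_le: "vnorm x \<le> r \<Longrightarrow> vnorm y \<le> r \<Longrightarrow> vnorm (x - y) \<le> r"
  by (simp add: vnorm_le_iff padic_abs_diff_le)

lemma vnorm_0 [simp]: "vnorm 0 = 0"
  by (simp add: vnorm_def)

lemma vnorm_scale_le_iff:
  "vnorm (padic_p powi a *s x :: 'p::prime_card padic ^ 'd) \<le> real CARD('p) powi b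
    \<longleftrightarrow> vnorm x \<le> real CARD('p) powi (a + b)"
  by (simp add: vnorm_le_iff padic_abs_scale_le_iff)

lemma vresidue_add:
  "vnorm x \<le> 1 \<Longrightarrow> vnorm y \<le> 1 \<Longrightarrow> vresidue (x + y) = vresidue x + vresidue y"
  by (simp add: vresidue_def vec_eq_iff vnorm_le_iff padic_residue_add)

lemma vresidue_diff:
  assumes "vnorm x \<le> 1" "vnorm y \<le> 1"
  shows "vresidue (x - y) = vresidue x - vresidue y"
  using vresidue_add[of "x - y" y] vnorm_diff_le[of x 1 y] assms by simp

lemma vresidue_eq_0_iff:
  "vnorm x \<le> 1 \<Longrightarrow> vresidue (x :: 'p::prime_card padic ^ 'd) = 0 \<longleftrightarrow> vnorm x \<le> real CARD('p) powi - 1"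
  by (simp add: vresidue_def vec_eq_iff vnorm_le_iff padic_residue_eq_0_iff)

lemma vresidue_sum_scale:
  fixes e :: "'i \<Rightarrow> 'p::prime_card padic ^ 'd"
  assumes "\<And>i. i \<in> I \<Longrightarrow> padic_abs (c i) \<le> 1" "\<And>i. i \<in> I \<Longrightarrow> vnorm (e i) \<le> 1"
  shows "vresidue (\<Sum>i\<in>I. c i *s e i) = (\<Sum>i\<in>I. padic_residue (c i) *s vresidue (e i))"
    and "vnorm (\<Sum>i\<in>I. c i *s e i) \<le> 1"
proof -
  have le: "padic_abs (c i * e i $ l) \<le> 1" if "i \<in> I" for i l
    using assms(1)[OF that] assms(2)[OF that] by (simp add: padic_abs_mult vnorm_le_iff mult_le_one)
  show "vresidue (\<Sum>i\<in>I. c i *s e i) = (\<Sum>i\<in>I. padic_residue (c i) *s vresidue (e i))"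
    using assms padic_residue_sum[of I "\<lambda>i. c i * e i $ l" for l] le
    by (simp add: vresidue_def vec_eq_iff vnorm_le_iff padic_residue_mult cong: sum.cong)
  show "vnorm (\<Sum>i\<in>I. c i *s e i) \<le> 1"
    using padic_residue_sum[of I "\<lambda>i. c i * e i $ l" for l] le by (simp add: vnorm_le_iff)
qed

section \<open>Haar measure and isometries of weighted maximum norms\<close>

lemma padic_cball: "{y. padic_abs (y - a) \<le> r} = cball (a :: 'p::prime_card padic) r"
  using padic_abs_uminus[of "a - y" for y] by (auto simp: dist_padic_def)

lemma padic_cball_0: "{y. padic_abs y \<le> r} = cball (0 :: 'p::prime_card padic) r"
  using padic_cball[of 0 r] by simp

lemma haar_measure_cball:
  assumes "haar_measure \<mu>"
  shows "emeasure \<mu> {y. padic_abs (y - a) \<le> r} = emeasure \<mu> {y. padic_abs y \<le> r}"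
proof -
  have "{y. padic_abs (y - a) \<le> r} = (\<lambda>y. a + y) ` {y. padic_abs y \<le> r}"
    by (auto intro!: image_eqI[of _ _ "y - a" for y])
  moreover have "{y. padic_abs y \<le> r} \<in> sets \<mu>"
    using assms by (simp add: haar_measure_def padic_cball_0)
  ultimately show ?thesis using assms by (simp add: haar_measure_def)
qed

lemma haar_measure_cball_le_1:
  assumes "haar_measure \<mu>" "r \<le> 1"
  shows "emeasure \<mu> {y. padic_abs (y - a) \<le> r} \<le> 1"
proof -
  have "{y :: 'a padic. padic_abs y \<le> 1} \<in> sets \<mu>"
    using assms(1) by (simp add: haar_measure_def padic_cball_0)
  then have "emeasure \<mu> {y. padic_abs y \<le> r} \<le> emeasure \<mu> {y. padic_abs y \<le> 1}"
    by (rule emeasure_mono[rotated]) (use assms(2) in auto)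
  then show ?thesis using assms(1) by (simp only: haar_measure_cball[OF assms(1)]) (simp add: haar_measure_def)
qed

lemma haar_measure_sigma_finite:
  fixes \<mu> :: "'p::prime_card padic measure"
  assumes "haar_measure \<mu>"
  shows "sigma_finite_measure \<mu>"
proof
  obtain Q :: "'p padic set" where Q: "countable Q"
    "\<And>x. \<exists>q\<in>Q. padic_abs (x - q) \<le> real CARD('p) powi 0"
    using padic_countable_dense by blast
  have sets: "sets \<mu> = sets borel" using assms by (simp add: haar_measure_def)
  have "emeasure \<mu> {y. padic_abs (y - q) \<le> 1} \<noteq> \<infinity>" for q
    using haar_measure_cball_le_1[OF assms, of 1 q] by (auto simp: top_unique)
  moreover have "{y. padic_abs (y - q) \<le> 1} \<in> sets \<mu>" for q
    unfolding sets padic_cball by simp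
  moreover have "(\<Union>q\<in>Q. {y. padic_abs (y - q) \<le> 1}) = space \<mu>"
    using Q(2) sets_eq_imp_space_eq[OF sets] by auto
  ultimately show "\<exists>A. countable A \<and> A \<subseteq> sets \<mu> \<and> \<Union> A = space \<mu> \<and> (\<forall>a\<in>A. emeasure \<mu> a \<noteq> \<infinity>)"
    using Q(1) by (intro exI[of _ "(\<lambda>q. {y. padic_abs (y - q) \<le> 1}) ` Q"]) auto
qed

text \<open>
  These are the balls of the ultrametric norm \<open>max\<^sub>i (\<bar>z\<^sub>i\<bar> / p\<^sup>w\<^sup>i)\<close>, where \<open>w\<^sub>i\<close> is the weight of the
  coordinate \<open>i\<close>.
\<close>

definition weighted_ball ::
  "'i set \<Rightarrow> ('i \<Rightarrow> int) \<Rightarrow> ('i \<Rightarrow> 'p::prime_card padic) \<Rightarrow> int \<Rightarrow> ('i \<Rightarrow> 'p padic) set" where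
  "weighted_ball I w a \<delta> =
     (\<Pi>\<^sub>E i\<in>I. {y. padic_abs (y - a i) \<le> real CARD('p) powi (\<delta> + w i)})"

lemma weighted_ball_iff:
  "z \<in> weighted_ball I w (a :: 'i \<Rightarrow> 'p::prime_card padic) \<delta> \<longleftrightarrow> z \<in> I \<rightarrow>\<^sub>E UNIV \<and>
     (\<forall>i\<in>I. padic_abs (z i - a i) \<le> real CARD('p) powi (\<delta> + w i))"
  by (auto simp: weighted_ball_def PiE_iff)

text \<open>
  The ultrametric inequality: every point of a ball is a centre of it.  Consequently two balls are
  nested or disjoint, which makes the family of balls stable under intersection.
\<close>

lemma weighted_ball_recenter:
  fixes a b :: "'i \<Rightarrow> 'p::prime_card padic"
  assumes "b \<in> weighted_ball I w a \<delta>"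
  shows "weighted_ball I w b \<delta> = weighted_ball I w a \<delta>"
proof -
  have "padic_abs (y - b i) \<le> real CARD('p) powi (\<delta> + w i) \<longleftrightarrow>
      padic_abs (y - a i) \<le> real CARD('p) powi (\<delta> + w i)" if "i \<in> I" for i y
    using assms that
      padic_abs_add_le[of "y - b i" "real CARD('p) powi (\<delta> + w i)" "b i - a i"]
      padic_abs_diff_le[of "y - a i" "real CARD('p) powi (\<delta> + w i)" "b i - a i"]
    by (auto simp: weighted_ball_iff)
  then show ?thesis by (auto simp: weighted_ball_iff)
qed

lemma weighted_ball_mono: "\<delta> \<le> \<epsilon> \<Longrightarrow> weighted_ball I w a \<delta> \<subseteq> weighted_ball I w (a :: 'i \<Rightarrow> 'p::prime_card padic) \<epsilon>"
proof
  fix z assume le: "\<delta> \<le> \<epsilon>" and z: "z \<in> weighted_ball I w a \<delta>"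
  have "real CARD('p) powi (\<delta> + w i) \<le> real CARD('p) powi (\<epsilon> + w i)" for i
    using le by (simp add: padic_powi_le_cancel)
  then show "z \<in> weighted_ball I w a \<epsilon>"
    using z unfolding weighted_ball_iff by (blast intro: order_trans)
qed

lemma weighted_ball_Int:
  "weighted_ball I w a \<delta> \<inter> weighted_ball I w b \<epsilon> \<in> {{}, weighted_ball I w a \<delta>, weighted_ball I w b \<epsilon>}"
proof (cases "weighted_ball I w a \<delta> \<inter> weighted_ball I w b \<epsilon> = {}")
  case False
  then obtain c where "c \<in> weighted_ball I w a \<delta>" "c \<in> weighted_ball I w b \<epsilon>" by blast
  then have "weighted_ball I w a \<delta> = weighted_ball I w c \<delta>" "weighted_ball I w b \<epsilon> = weighted_ball I w c \<epsilon>"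
    using weighted_ball_recenter by blast+
  then show ?thesis
    using weighted_ball_mono[of \<delta> \<epsilon> I w c] weighted_ball_mono[of \<epsilon> \<delta> I w c]
    by (cases "\<delta> \<le> \<epsilon>") auto
qed simp

text \<open>
  The empty set is included to close the family under intersections.
\<close>

definition weighted_balls :: "'i set \<Rightarrow> ('i \<Rightarrow> int) \<Rightarrow> ('i \<Rightarrow> 'p::prime_card padic) set set" where
  "weighted_balls I w = insert {} {weighted_ball I w a \<delta> | a \<delta>. a \<in> I \<rightarrow>\<^sub>E UNIV}"

lemma weighted_ballsI: "a \<in> I \<rightarrow>\<^sub>E UNIV \<Longrightarrow> weighted_ball I w a \<delta> \<in> weighted_balls I w"
  unfolding weighted_balls_def by blast

lemma weighted_ballsE:
  assumes "X \<in> weighted_balls I w"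
  obtains "X = {}" | a \<delta> where "X = weighted_ball I w a \<delta>" "a \<in> I \<rightarrow>\<^sub>E UNIV"
proof -
  have "X = {} \<or> (\<exists>a \<delta>. X = weighted_ball I w a \<delta> \<and> a \<in> I \<rightarrow>\<^sub>E UNIV)"
    using assms unfolding weighted_balls_def by simp
  then show thesis by (elim disjE exE conjE) (rule that; assumption)+
qed

lemma Int_stable_weighted_balls:
  "Int_stable (weighted_balls I w :: ('i \<Rightarrow> 'p::prime_card padic) set set)"
proof (rule Int_stableI)
  fix A B :: "('i \<Rightarrow> 'p padic) set"
  assume A: "A \<in> weighted_balls I w" and B: "B \<in> weighted_balls I w"
  have "A \<inter> B \<in> {{}, A, B}"
    using A
  proof (cases rule: weighted_ballsE)
    case (2 a \<delta>)
    show ?thesis using B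
    proof (cases rule: weighted_ballsE)
      case (2 b \<epsilon>)
      show ?thesis
        unfolding \<open>A = _\<close> \<open>B = _\<close> by (rule weighted_ball_Int)
    qed simp
  qed simp
  moreover have "{} \<in> weighted_balls I w" by (simp add: weighted_balls_def)
  ultimately show "A \<inter> B \<in> weighted_balls I w" using A B by auto
qed

lemma weighted_balls_Pow:
  "weighted_balls (I :: 'i set) w \<subseteq> Pow (I \<rightarrow>\<^sub>E (UNIV :: 'p::prime_card padic set))"
proof
  fix X :: "('i \<Rightarrow> 'p padic) set" assume "X \<in> weighted_balls I w"
  then show "X \<in> Pow (I \<rightarrow>\<^sub>E UNIV)"
    by (elim weighted_ballsE) (auto simp: weighted_ball_iff)
qed

lemma weighted_ball_countable_centers:
  assumes "finite I"
  shows "\<exists>C :: ('i \<Rightarrow> 'p::prime_card padic) set. countable C \<and> C \<subseteq> I \<rightarrow>\<^sub>E UNIV \<and>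
    (\<forall>z\<in>I \<rightarrow>\<^sub>E UNIV. \<forall>\<delta>. \<exists>c\<in>C. z \<in> weighted_ball I w c \<delta>)"
proof -
  obtain Q :: "'p padic set" where Q: "countable Q"
    "\<And>x \<gamma>. \<exists>q\<in>Q. padic_abs (x - q) \<le> real CARD('p) powi \<gamma>"
    using padic_countable_dense by blast
  show ?thesis
  proof (intro exI[of _ "I \<rightarrow>\<^sub>E Q"] conjI ballI allI)
    show "countable (I \<rightarrow>\<^sub>E Q)" using assms Q(1) by (intro countable_PiE) auto
    fix z \<delta> assume z: "z \<in> I \<rightarrow>\<^sub>E (UNIV :: 'p padic set)"
    have "\<forall>i. \<exists>q. q \<in> Q \<and> padic_abs (z i - q) \<le> real CARD('p) powi (\<delta> + w i)"
      using Q(2) by blast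
    then obtain q where q: "\<And>i. q i \<in> Q \<and> padic_abs (z i - q i) \<le> real CARD('p) powi (\<delta> + w i)"
      by metis
    then show "\<exists>c\<in>I \<rightarrow>\<^sub>E Q. z \<in> weighted_ball I w c \<delta>"
      using z by (intro bexI[of _ "restrict q I"]) (auto simp: weighted_ball_iff)
  qed (auto simp: PiE_iff)
qed

text \<open>
  A set that is open with respect to one coordinate is a union of weighted balls with centres in a
  countable set, and there are only countably many radii, so the balls generate every cylinder set.
\<close>

lemma sets_PiM_weighted_balls:
  fixes w :: "'i \<Rightarrow> int"
  assumes I: "finite I"
  shows "sets (\<Pi>\<^sub>M i\<in>I. (borel :: 'p::prime_card padic measure)) =
    sigma_sets (I \<rightarrow>\<^sub>E UNIV) (weighted_balls I w)" 
    (is "?L = sigma_sets ?\<Omega> ?G")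
proof
  define N where "N = sigma ?\<Omega> ?G"
  have N: "space N = ?\<Omega>" "sets N = sigma_sets ?\<Omega> ?G"
    unfolding N_def by (rule space_measure_of sets_measure_of, rule weighted_balls_Pow)+
  obtain C :: "('i \<Rightarrow> 'p padic) set" where centers: "countable C \<and> C \<subseteq> ?\<Omega> \<and>
      (\<forall>z\<in>?\<Omega>. \<forall>\<delta>. \<exists>c\<in>C. z \<in> weighted_ball I w c \<delta>)"
    using weighted_ball_countable_centers[OF I] by (rule exE)
  have C: "countable C" "C \<subseteq> ?\<Omega>"
    "\<And>z \<delta>. z \<in> ?\<Omega> \<Longrightarrow> \<exists>c\<in>C. z \<in> weighted_ball I w c \<delta>"
    using centers by simp_all
  have proj: "(\<lambda>z. z i) \<in> borel_measurable N" if i: "i \<in> I" for i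
  proof (rule borel_measurableI)
    fix S :: "'p padic set" assume S: "open S"
    \<comment> \<open>Centres and radii of the admissible balls inside the cylinder over \<open>S\<close>.\<close>
    let ?F = "{(c, \<delta>). c \<in> C \<and> weighted_ball I w c \<delta> \<subseteq> (\<lambda>z. z i) -` S}"
    have "countable ?F"
      by (rule countable_subset[of _ "C \<times> (UNIV :: int set)"]) (use C(1) in auto)
    moreover have "(\<lambda>z. z i) -` S \<inter> ?\<Omega> = (\<Union>(c, \<delta>)\<in>?F. weighted_ball I w c \<delta>)"
    proof
      show "(\<lambda>z. z i) -` S \<inter> ?\<Omega> \<subseteq> (\<Union>(c, \<delta>)\<in>?F. weighted_ball I w c \<delta>)"
      proof
        fix z assume z: "z \<in> (\<lambda>z. z i) -` S \<inter> ?\<Omega>"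
        then obtain e where e: "e > 0" "\<And>y. dist y (z i) < e \<Longrightarrow> y \<in> S"
          using S by (auto simp: open_dist)
        obtain n where n: "(1 / real CARD('p)) ^ n < e"
          using real_arch_pow_inv[OF e(1), of "1 / real CARD('p)"] padic_card_gt_1[where 'p='p] by auto
        define \<delta> where "\<delta> = - int n - w i"
        obtain c where c: "c \<in> C" "z \<in> weighted_ball I w c \<delta>" using C(3) z by blast
        have "y i \<in> S" if "y \<in> weighted_ball I w z \<delta>" for y
        proof (rule e(2))
          have "padic_abs (y i - z i) \<le> real CARD('p) powi - int n"
            using that i by (auto simp: weighted_ball_iff \<delta>_def)
          also have "\<dots> = (1 / real CARD('p)) ^ n"
            by (simp add: power_int_minus power_inverse divide_inverse)
          finally show "dist (y i) (z i) < e" using n by (simp add: dist_padic_def)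
        qed
        then have "(c, \<delta>) \<in> ?F" using c weighted_ball_recenter[OF c(2)] by auto
        then show "z \<in> (\<Union>(c, \<delta>)\<in>?F. weighted_ball I w c \<delta>)" using c(2) by blast
      qed
    qed (auto simp: weighted_ball_iff)
    moreover have "weighted_ball I w c \<delta> \<in> sets N" if "c \<in> C" for c \<delta>
      unfolding N using that C(2) by (intro sigma_sets.Basic weighted_ballsI) auto
    ultimately show "(\<lambda>z. z i) -` S \<inter> space N \<in> sets N"
      unfolding N(1) by (auto intro!: sets.countable_UN')
  qed
  show "?L \<subseteq> sigma_sets ?\<Omega> ?G"
    unfolding N(2)[symmetric]
  proof (rule sets_PiM_in_sets)
    fix i and A :: "'p padic set" assume "i \<in> I" "A \<in> sets borel"
    then show "{z \<in> space N. z i \<in> A} \<in> sets N" using measurable_sets[OF proj, of i A]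
      by (simp add: vimage_def Int_def conj_commute)
  qed (simp add: N)
  have "weighted_ball I w a \<delta> \<in> ?L" for a :: "'i \<Rightarrow> 'p padic" and \<delta>
    unfolding weighted_ball_def padic_cball using I by (intro sets_PiM_I_finite) auto
  then have "?G \<subseteq> ?L" by (auto simp: weighted_balls_def)
  then show "sigma_sets ?\<Omega> ?G \<subseteq> ?L"
    using sets.sigma_sets_subset[of ?G "\<Pi>\<^sub>M i\<in>I. (borel :: 'p padic measure)"] by (simp add: space_PiM)
qed

text \<open>
  The value does not mention the centre \<open>a\<close>; this is how translation invariance of the product
  measure enters.
\<close>

lemma emeasure_PiM_weighted_ball:
  fixes \<mu> :: "'p::prime_card padic measure"
  assumes "haar_measure \<mu>" "finite I"
  shows "emeasure (\<Pi>\<^sub>M i\<in>I. \<mu>) (weighted_ball I w a \<delta>) =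
    (\<Prod>i\<in>I. emeasure \<mu> {y. padic_abs y \<le> real CARD('p) powi (\<delta> + w i)})"
proof -
  interpret product_sigma_finite "\<lambda>_ :: 'b. \<mu>"
    using haar_measure_sigma_finite[OF assms(1)] by (rule product_sigma_finite.intro)
  have "sets \<mu> = sets borel" using assms(1) by (simp add: haar_measure_def)
  then show ?thesis unfolding weighted_ball_def
    using assms(2) by (subst emeasure_PiM) (simp_all add: haar_measure_cball[OF assms(1)], simp add: padic_cball)
qed

text \<open>
  A surjective isometry pulls balls back to balls of the same radius, and these have the same measure.
  The balls form an intersection-stable generator, so the image measure is the measure itself.
\<close>

lemma distr_PiM_haar_isometry:
  fixes \<mu> :: "'p::prime_card padic measure" and w :: "'i \<Rightarrow> int"
  assumes \<mu>: "haar_measure \<mu>" and I: "finite I"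
    and surj: "T ` (I \<rightarrow>\<^sub>E UNIV) = I \<rightarrow>\<^sub>E UNIV"
    and iso: "\<And>z z' \<delta>. z \<in> I \<rightarrow>\<^sub>E UNIV \<Longrightarrow> z' \<in> I \<rightarrow>\<^sub>E UNIV \<Longrightarrow>
      T z \<in> weighted_ball I w (T z') \<delta> \<longleftrightarrow> z \<in> weighted_ball I w z' \<delta>"
  shows "T \<in> measurable (\<Pi>\<^sub>M i\<in>I. \<mu>) (\<Pi>\<^sub>M i\<in>I. \<mu>)"
    and "distr (\<Pi>\<^sub>M i\<in>I. \<mu>) (\<Pi>\<^sub>M i\<in>I. \<mu>) T = (\<Pi>\<^sub>M i\<in>I. \<mu>)"
proof -
  let ?P = "\<Pi>\<^sub>M i\<in>I. \<mu>" and ?\<Omega> = "I \<rightarrow>\<^sub>E (UNIV :: 'p padic set)"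
  have sets_\<mu>: "sets \<mu> = sets borel" using \<mu> by (simp add: haar_measure_def)
  have sets: "sets ?P = sigma_sets ?\<Omega> (weighted_balls I w)"
    using sets_PiM_weighted_balls[OF I] sets_PiM_cong[of I I "\<lambda>_. \<mu>" "\<lambda>_. borel"] sets_\<mu> by simp
  have space: "space ?P = ?\<Omega>" using sets_eq_imp_space_eq[OF sets_\<mu>] by (simp add: space_PiM)
  have TO: "T z \<in> ?\<Omega>" if "z \<in> ?\<Omega>" for z using surj that by blast
  have vimage: "\<exists>b\<in>?\<Omega>. T -` weighted_ball I w a \<delta> \<inter> ?\<Omega> = weighted_ball I w b \<delta>" if "a \<in> ?\<Omega>" for a \<delta>
  proof -
    have "a \<in> T ` ?\<Omega>" using that unfolding surj .
    then obtain b where "b \<in> ?\<Omega>" "a = T b" by (elim imageE)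
    then have "T z \<in> weighted_ball I w a \<delta> \<longleftrightarrow> z \<in> weighted_ball I w b \<delta>" if "z \<in> ?\<Omega>" for z
      using iso[OF that] by simp
    moreover have "weighted_ball I w b \<delta> \<subseteq> ?\<Omega>" by (auto simp: weighted_ball_iff)
    ultimately show ?thesis using \<open>b \<in> ?\<Omega>\<close> by blast
  qed
  show meas: "T \<in> measurable ?P ?P"
  proof (rule measurable_sigma_sets[OF sets weighted_balls_Pow])
    fix A :: "('i \<Rightarrow> 'p padic) set" assume A: "A \<in> weighted_balls I w"
    show "T -` A \<inter> space ?P \<in> sets ?P"
      using A
    proof (cases rule: weighted_ballsE)
      case (2 a \<delta>)
      then obtain b where "b \<in> ?\<Omega>" "T -` A \<inter> ?\<Omega> = weighted_ball I w b \<delta>"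
        using vimage[OF 2(2), of \<delta>] by auto
      then show ?thesis unfolding space sets by (simp add: sigma_sets.Basic weighted_ballsI)
    qed simp
  qed (use TO space in auto)
  obtain C :: "('i \<Rightarrow> 'p padic) set" where centers: "countable C \<and> C \<subseteq> ?\<Omega> \<and>
      (\<forall>z\<in>?\<Omega>. \<forall>\<delta>. \<exists>c\<in>C. z \<in> weighted_ball I w c \<delta>)"
    using weighted_ball_countable_centers[OF I] by (rule exE)
  have C: "countable C" "C \<subseteq> ?\<Omega>"
    "\<And>z \<delta>. z \<in> ?\<Omega> \<Longrightarrow> \<exists>c\<in>C. z \<in> weighted_ball I w c \<delta>"
    using centers by simp_all
  have "C \<noteq> {}" using C(3)[of "\<lambda>i. undefined"] by auto
  \<comment> \<open>A radius so small that each side of the box is at most 1 and the box has finite measure.\<close>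
  define \<delta> where "\<delta> = - (\<Sum>i\<in>I. \<bar>w i\<bar>)"
  define A where "A n = weighted_ball I w (from_nat_into C n) \<delta>" for n
  have mem: "from_nat_into C n \<in> C" for n using \<open>C \<noteq> {}\<close> by (rule from_nat_into)
  have A: "A n \<in> weighted_balls I w" for n
    unfolding A_def using mem[of n] C(2) by (intro weighted_ballsI) auto
  have cover: "(\<Union>n. A n) = ?\<Omega>"
  proof
    show "?\<Omega> \<subseteq> (\<Union>n. A n)"
    proof
      fix z assume "z \<in> ?\<Omega>"
      then obtain c where "c \<in> C" "z \<in> weighted_ball I w c \<delta>" using C(3) by blast
      then show "z \<in> (\<Union>n. A n)" unfolding A_def using from_nat_into_surj[OF C(1)] by blast
    qed
  qed (use weighted_balls_Pow A in blast)
  have finite: "emeasure ?P (A n) \<noteq> \<infinity>" for n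
  proof -
    have "\<delta> + w i \<le> 0" if "i \<in> I" for i
      using member_le_sum[OF that, of "\<lambda>i. \<bar>w i\<bar>"] I by (simp add: \<delta>_def)
    then have "emeasure \<mu> {y. padic_abs y \<le> real CARD('p) powi (\<delta> + w i)} \<le> 1" if "i \<in> I" for i
      using that haar_measure_cball_le_1[OF \<mu>, of "real CARD('p) powi (\<delta> + w i)" 0]
        padic_powi_le_cancel[where 'p='p, of "\<delta> + w i" 0] by simp
    then have "emeasure ?P (A n) \<le> (\<Prod>i\<in>I. 1)"
      unfolding A_def emeasure_PiM_weighted_ball[OF \<mu> I] by (intro prod_mono_ennreal) auto
    then show ?thesis by (auto simp: top_unique)
  qed
  have "?P = distr ?P ?P T"
  proof (rule measure_eqI_generator_eq[OF Int_stable_weighted_balls weighted_balls_Pow])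
    fix X :: "('i \<Rightarrow> 'p padic) set" assume X: "X \<in> weighted_balls I w"
    have XP: "X \<in> sets ?P" using X unfolding sets by (rule sigma_sets.Basic)
    show "emeasure ?P X = emeasure (distr ?P ?P T) X"
      using X
    proof (cases rule: weighted_ballsE)
      case (2 a \<delta>)
      then obtain b where "T -` X \<inter> ?\<Omega> = weighted_ball I w b \<delta>"
        using vimage[OF 2(2), of \<delta>] by auto
      then show ?thesis
        using emeasure_distr[OF meas XP] emeasure_PiM_weighted_ball[OF \<mu> I] 2(1) by (simp add: space)
    qed simp
  next
    show "sets ?P = sigma_sets ?\<Omega> (weighted_balls I w)" by (rule sets)
    show "sets (distr ?P ?P T) = sigma_sets ?\<Omega> (weighted_balls I w)" using sets by simp
    show "range A \<subseteq> weighted_balls I w" using A by auto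
    show "(\<Union>n. A n) = ?\<Omega>" by (rule cover)
    show "emeasure ?P (A n) \<noteq> \<infinity>" for n by (rule finite)
  qed
  then show "distr ?P ?P T = ?P" ..
qed

section \<open>Parametrisation by an adapted frame\<close>

text \<open>
  The families of this part are indexed by \<open>1, \<dots>, d\<close> and not by the index type of the vectors.  The
  two facts on families of \<open>d\<close> vectors in a space of dimension \<open>d\<close> come from left and right
  invertibility of the square matrix with these columns, after relabelling the indices.
\<close>

lemma spanning_family_independent:
  fixes e :: "nat \<Rightarrow> 'k::field ^ 'd"
  assumes span: "vec.span (e ` {1..CARD('d)}) = UNIV"
    and zero: "(\<Sum>l=1..CARD('d). c l *s e l) = 0" and l: "l \<in> {1..CARD('d)}"
  shows "c l = 0"
proof -
  obtain h :: "'d \<Rightarrow> nat" where h: "bij_betw h UNIV {1..CARD('d)}"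
    using finite_same_card_bij[of "UNIV :: 'd set" "{1..CARD('d)}"] by auto
  define A :: "'k ^ 'd ^ 'd" where "A = (\<chi> i j. e (h j) $ i)"
  have col: "column j A = e (h j)" for j by (simp add: A_def column_def vec_eq_iff)
  have "columns A = e ` range h" unfolding columns_def col by auto
  then have "vec.span (columns A) = UNIV"
    using span bij_betw_imp_surj_on[OF h] by simp
  then have "\<exists>B. B ** A = mat 1"
    using matrix_right_invertible_span_columns[of A] matrix_left_right_inverse[of A] by auto
  moreover have "(\<Sum>j\<in>UNIV. c (h j) *s column j A) = 0"
    unfolding col using sum.reindex_bij_betw[OF h, of "\<lambda>l. c l *s e l"] zero by simp
  ultimately have "c (h j) = 0" for j
    using matrix_left_invertible_independent_columns[of A] by (auto dest: spec[of _ "\<lambda>j. c (h j)"])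
  moreover obtain j where "l = h j" using l bij_betw_imp_surj_on[OF h] by blast
  ultimately show ?thesis by simp
qed

lemma independent_family_spans:
  fixes e :: "nat \<Rightarrow> 'k::field ^ 'd"
  assumes indep: "\<And>c l. (\<Sum>l=1..CARD('d). c l *s e l) = 0 \<Longrightarrow> l \<in> {1..CARD('d)} \<Longrightarrow> c l = 0"
  shows "\<exists>c \<in> {1..CARD('d)} \<rightarrow>\<^sub>E UNIV. y = (\<Sum>l=1..CARD('d). c l *s e l)"
proof -
  obtain h :: "'d \<Rightarrow> nat" where h: "bij_betw h UNIV {1..CARD('d)}"
    using finite_same_card_bij[of "UNIV :: 'd set" "{1..CARD('d)}"] by auto
  define h' where "h' = the_inv_into UNIV h"
  have h'h: "h' (h j) = j" for j
    unfolding h'_def using h by (simp add: the_inv_into_f_f bij_betw_def)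
  define A :: "'k ^ 'd ^ 'd" where "A = (\<chi> i j. e (h j) $ i)"
  have col: "column j A = e (h j)" for j by (simp add: A_def column_def vec_eq_iff)
  have "c j = 0" if "(\<Sum>j\<in>UNIV. c j *s column j A) = 0" for c j
  proof -
    have "(\<Sum>l=1..CARD('d). c (h' l) *s e l) = 0"
      using that sum.reindex_bij_betw[OF h, of "\<lambda>l. c (h' l) *s e l"] by (simp add: h'h col)
    then have "c (h' (h j)) = 0" by (rule indep) (use bij_betwE[OF h] in auto)
    then show ?thesis by (simp add: h'h)
  qed
  then have "\<exists>B. B ** A = mat 1"
    using matrix_left_invertible_independent_columns[of A] by blast
  then have "\<exists>B. A ** B = mat 1" using matrix_left_right_inverse by blast
  then obtain v where v: "y = A *v v" using matrix_right_invertible_surjective[of A] by blast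
  have "y = (\<Sum>j\<in>UNIV. v $ j *s e (h j))" by (simp add: v matrix_mult_sum col)
  also have "\<dots> = (\<Sum>l=1..CARD('d). restrict (\<lambda>l. v $ h' l) {1..CARD('d)} l *s e l)"
    using sum.reindex_bij_betw[OF h, of "\<lambda>l. v $ h' l *s e l"] by (simp add: h'h)
  finally show ?thesis by (rule bexI[where x = "restrict (\<lambda>l. v $ h' l) {1..CARD('d)}"]) simp
qed

text \<open>
  The conditions on \<open>k\<^sub>1(B), \<dots>, k\<^sub>d(B)\<close> at a single ball \<open>B\<close>; \<open>\<kappa>\<close> is the direction \<open>k(B)\<close>.
\<close>

locale padic_frame =
  fixes \<kappa> :: "'p::prime_card mod_ring ^ 'd" and e :: "nat \<Rightarrow> 'p padic ^ 'd"
  assumes norm_first: "vnorm (e 1) = 1"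
    and residue_first: "vresidue (e 1) = \<kappa>"
    and norm_rest: "\<And>l. l \<in> {2..CARD('d)} \<Longrightarrow> vnorm (e l) = real CARD('p) powi - 1"
    and span_residues: "vec.span (insert (vresidue (e 1))
       ((\<lambda>l. vresidue (padic_p powi - 1 *s e l)) ` {2..CARD('d)})) = UNIV"

lemma adapted_frame_iff: "adapted_frame k K \<longleftrightarrow> (\<forall>B\<in>balls. padic_frame (k B) (K B))"
  unfolding adapted_frame_def padic_frame_def by (simp only: Ball_def conj_assoc)

text \<open>
  The frame vector \<open>k\<^sub>l\<close> has norm \<open>p powi (- frame_weight l)\<close>.
\<close>

definition frame_weight :: "nat \<Rightarrow> int" where
  "frame_weight l = (if l = 1 then 0 else 1)"

definition frame_map :: "(nat \<Rightarrow> 'p::prime_card padic ^ 'd) \<Rightarrow> (nat \<Rightarrow> 'p padic) \<Rightarrow> 'p padic ^ 'd" where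
  "frame_map e z = (\<Sum>l=1..CARD('d). z l *s e l)"

lemma frame_map_diff: "frame_map e (\<lambda>l. z l - z' l) = frame_map e z - frame_map e z'"
  by (simp add: frame_map_def vector_sub_rdistrib sum_subtractf)

lemma padic_abs_arbitrarily_small:
  assumes "\<And>\<gamma>. padic_abs x \<le> real CARD('p) powi \<gamma>"
  shows "(x :: 'p::prime_card padic) = 0"
proof (rule ccontr)
  assume "x \<noteq> 0"
  then obtain m where "padic_abs x = real CARD('p) powi m" by (rule padic_abs_values)
  then show False using assms[of "m - 1"] by (simp add: padic_powi_le_cancel)
qed

context padic_frame
begin

text \<open>
  The frame vectors rescaled to norm 1: their residues are a basis of the residue space.
\<close>

definition unit_vector :: "nat \<Rightarrow> 'p padic ^ 'd" where
  "unit_vector l = padic_p powi (- frame_weight l) *s e l"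

lemma one_in_indices: "1 \<in> {1..CARD('d)}"
  using zero_less_card_finite[where 'a='d] by (simp add: Suc_le_eq)

lemma unit_vector_1: "unit_vector 1 = e 1"
  by (simp add: unit_vector_def frame_weight_def)

lemma vnorm_unit_vector: "l \<in> {1..CARD('d)} \<Longrightarrow> vnorm (unit_vector l) \<le> 1"
  using vnorm_scale_le_iff[of "- frame_weight l" "e l" 0] norm_first norm_rest[of l]
  by (cases "l = 1") (simp_all add: unit_vector_def frame_weight_def)

lemma span_unit_vectors: "vec.span ((\<lambda>l. vresidue (unit_vector l)) ` {1..CARD('d)}) = UNIV"
proof -
  have "{1..CARD('d)} = insert 1 {2..CARD('d)}" using one_in_indices by auto
  then have "(\<lambda>l. vresidue (unit_vector l)) ` {1..CARD('d)} =
      insert (vresidue (e 1)) ((\<lambda>l. vresidue (padic_p powi - 1 *s e l)) ` {2..CARD('d)})"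
    by (auto simp: unit_vector_def frame_weight_def intro!: image_eqI)
  then show ?thesis using span_residues by simp
qed

lemma frame_map_scaled:
  "padic_p powi \<gamma> *s frame_map e z =
     (\<Sum>l=1..CARD('d). (padic_p powi (\<gamma> + frame_weight l) * z l) *s unit_vector l)"
  unfolding frame_map_def vec.scale_sum_right
proof (rule sum.cong)
  fix l
  have "padic_p powi (\<gamma> + frame_weight l) * padic_p powi (- frame_weight l) = (padic_p powi \<gamma> :: 'p padic)"
    by (simp flip: power_int_add)
  then show "padic_p powi \<gamma> *s (z l *s e l) =
      (padic_p powi (\<gamma> + frame_weight l) * z l) *s unit_vector l"
    by (simp add: unit_vector_def vector_smult_assoc mult.assoc mult.commute[of "z l"])
qed simp

text \<open>
  In terms of the rescaled vectors, the bounds say that \<open>p\<^sup>\<gamma> M z\<close> is a combination with integral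
  coefficients, so it can be reduced coefficient by coefficient.
\<close>

lemma frame_map_residue:
  assumes "\<And>l. l \<in> {1..CARD('d)} \<Longrightarrow> padic_abs (z l) \<le> real CARD('p) powi (\<gamma> + frame_weight l)"
  shows "vnorm (frame_map e z) \<le> real CARD('p) powi \<gamma>"
    and "vresidue (padic_p powi \<gamma> *s frame_map e z) =
      (\<Sum>l=1..CARD('d). padic_residue (padic_p powi (\<gamma> + frame_weight l) * z l) *s vresidue (unit_vector l))"
proof -
  have le: "padic_abs (padic_p powi (\<gamma> + frame_weight l) * z l) \<le> 1" if "l \<in> {1..CARD('d)}" for l
    using assms[OF that] padic_abs_scale_le_iff[of "\<gamma> + frame_weight l" "z l" 0] by simp
  note sums = vresidue_sum_scale[of "{1..CARD('d)}", OF le vnorm_unit_vector]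
  show "vnorm (frame_map e z) \<le> real CARD('p) powi \<gamma>"
    using sums(2) vnorm_scale_le_iff[of \<gamma> "frame_map e z" 0] by (simp add: frame_map_scaled)
  show "vresidue (padic_p powi \<gamma> *s frame_map e z) =
      (\<Sum>l=1..CARD('d). padic_residue (padic_p powi (\<gamma> + frame_weight l) * z l) *s vresidue (unit_vector l))"
    unfolding frame_map_scaled by (rule sums(1))
qed

text \<open>
  The norm of \<open>M z\<close> is a weighted maximum norm of \<open>z\<close> that does not depend on the frame.  For the
  nontrivial direction, suppose that the coordinates satisfy the bounds with some \<open>\<delta> > \<gamma>\<close>.  Then
  \<open>p\<^sup>\<delta> M z\<close> reduces to 0, and by independence of the residues so does every coefficient: the bounds
  hold with \<open>\<delta> - 1\<close>.  Descend from a large \<open>\<delta>\<close> to \<open>\<gamma>\<close>.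
\<close>

lemma vnorm_frame_map_le_iff:
  "vnorm (frame_map e z) \<le> real CARD('p) powi \<gamma> \<longleftrightarrow>
    (\<forall>l\<in>{1..CARD('d)}. padic_abs (z l) \<le> real CARD('p) powi (\<gamma> + frame_weight l))"
proof
  define P where "P \<delta> \<longleftrightarrow> (\<forall>l\<in>{1..CARD('d)}. padic_abs (z l) \<le> real CARD('p) powi (\<delta> + frame_weight l))" for \<delta>
  assume le: "vnorm (frame_map e z) \<le> real CARD('p) powi \<gamma>"
  have step: "P (\<delta> - 1)" if "P \<delta>" "\<gamma> < \<delta>" for \<delta>
  proof -
    have "real CARD('p) powi \<gamma> \<le> real CARD('p) powi (\<delta> - 1)"
      using that(2) by (simp add: padic_powi_le_cancel)
    then have "vnorm (frame_map e z) \<le> real CARD('p) powi (\<delta> - 1)" using le by linarith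
    then have "vnorm (padic_p powi \<delta> *s frame_map e z) \<le> real CARD('p) powi - 1"
      unfolding vnorm_scale_le_iff by simp
    moreover have "real CARD('p) powi - 1 \<le> 1"
      using padic_powi_le_cancel[where 'p='p, of "- 1" 0] by simp
    ultimately have "vresidue (padic_p powi \<delta> *s frame_map e z) = 0"
      by (subst vresidue_eq_0_iff) auto
    then have "(\<Sum>l=1..CARD('d). padic_residue (padic_p powi (\<delta> + frame_weight l) * z l)
        *s vresidue (unit_vector l)) = 0"
      using frame_map_residue(2)[of z \<delta>] that(1) by (simp add: P_def)
    then have zero: "padic_residue (padic_p powi (\<delta> + frame_weight l) * z l) = 0" if "l \<in> {1..CARD('d)}" for l
      using spanning_family_independent[OF span_unit_vectors,
        of "\<lambda>l. padic_residue (padic_p powi (\<delta> + frame_weight l) * z l)", OF _ that] by blast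
    show ?thesis unfolding P_def
    proof
      fix l assume l: "l \<in> {1..CARD('d)}"
      have "padic_abs (padic_p powi (\<delta> + frame_weight l) * z l) \<le> 1"
        using that(1) l padic_abs_scale_le_iff[of "\<delta> + frame_weight l" "z l" 0] by (simp add: P_def)
      then have "padic_abs (padic_p powi (\<delta> + frame_weight l) * z l) \<le> real CARD('p) powi - 1"
        using zero[OF l] padic_residue_eq_0_iff by blast
      then show "padic_abs (z l) \<le> real CARD('p) powi (\<delta> - 1 + frame_weight l)"
        unfolding padic_abs_scale_le_iff by (simp add: algebra_simps)
    qed
  qed
  have "\<exists>m. padic_abs (z l) \<le> real CARD('p) powi m" for l
  proof (cases "z l = 0")
    case False
    then obtain m where "padic_abs (z l) = real CARD('p) powi m" by (rule padic_abs_values)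
    then show ?thesis by (intro exI[of _ m]) simp
  qed simp
  then obtain m where m: "\<And>l. padic_abs (z l) \<le> real CARD('p) powi (m l)" by metis
  define \<delta>\<^sub>0 where "\<delta>\<^sub>0 = \<bar>\<gamma>\<bar> + (\<Sum>l=1..CARD('d). \<bar>m l\<bar>)"
  have "P \<delta>\<^sub>0" unfolding P_def
  proof
    fix l assume l: "l \<in> {1..CARD('d)}"
    have "\<bar>m l\<bar> \<le> (\<Sum>l=1..CARD('d). \<bar>m l\<bar>)" by (rule member_le_sum[OF l]) auto
    then have "m l \<le> \<delta>\<^sub>0" unfolding \<delta>\<^sub>0_def by linarith
    moreover have "frame_weight l \<ge> 0" by (simp add: frame_weight_def)
    ultimately have "m l \<le> \<delta>\<^sub>0 + frame_weight l" by linarith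
    then have "real CARD('p) powi m l \<le> real CARD('p) powi (\<delta>\<^sub>0 + frame_weight l)"
      by (simp add: padic_powi_le_cancel)
    then show "padic_abs (z l) \<le> real CARD('p) powi (\<delta>\<^sub>0 + frame_weight l)" using m[of l] by linarith
  qed
  then have descend: "P (\<delta>\<^sub>0 - int n)" if "int n \<le> \<delta>\<^sub>0 - \<gamma>" for n
    using that
  proof (induction n)
    case (Suc n)
    then show ?case using step[of "\<delta>\<^sub>0 - int n"] by (simp add: algebra_simps)
  qed simp
  have "(\<Sum>l=1..CARD('d). \<bar>m l\<bar>) \<ge> 0" by (rule sum_nonneg) simp
  then have "\<gamma> \<le> \<delta>\<^sub>0" unfolding \<delta>\<^sub>0_def by linarith
  then have "P \<gamma>" using descend[of "nat (\<delta>\<^sub>0 - \<gamma>)"] by simp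
  then show "\<forall>l\<in>{1..CARD('d)}. padic_abs (z l) \<le> real CARD('p) powi (\<gamma> + frame_weight l)"
    by (simp add: P_def)
qed (use frame_map_residue(1) in blast)

text \<open>
  A vector \<open>M z = 0\<close> satisfies all norm bounds at once, so \<open>z = 0\<close>: the frame is linearly independent,
  hence a basis.
\<close>

lemma frame_map_bij: "bij_betw (frame_map e) ({1..CARD('d)} \<rightarrow>\<^sub>E UNIV) UNIV"
proof -
  have indep: "c l = 0" if "frame_map e c = 0" "l \<in> {1..CARD('d)}" for c l
  proof (rule padic_abs_arbitrarily_small)
    fix \<gamma>
    have "vnorm (frame_map e c) \<le> real CARD('p) powi (\<gamma> - frame_weight l)" using that(1) by simp
    then have "padic_abs (c l) \<le> real CARD('p) powi (\<gamma> - frame_weight l + frame_weight l)"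
      using that(2) unfolding vnorm_frame_map_le_iff by blast
    then show "padic_abs (c l) \<le> real CARD('p) powi \<gamma>" by simp
  qed
  have "inj_on (frame_map e) ({1..CARD('d)} \<rightarrow>\<^sub>E UNIV)"
  proof (rule inj_onI)
    fix y z assume yz: "y \<in> {1..CARD('d)} \<rightarrow>\<^sub>E UNIV" "z \<in> {1..CARD('d)} \<rightarrow>\<^sub>E UNIV"
      "frame_map e y = frame_map e z"
    then have "frame_map e (\<lambda>l. y l - z l) = 0" by (simp add: frame_map_diff)
    then have "y l = z l" if "l \<in> {1..CARD('d)}" for l using indep that by fastforce
    then show "y = z" using yz by (intro PiE_ext) auto
  qed
  moreover have "y \<in> frame_map e ` ({1..CARD('d)} \<rightarrow>\<^sub>E UNIV)" for y
    using independent_family_spans[of e y] indep unfolding frame_map_def by blast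
  ultimately show ?thesis by (auto simp: bij_betw_def)
qed

text \<open>
  Read off the coefficients of the reduction of \<open>p\<^sup>\<gamma> M z\<close> in the residue basis: the coefficient of
  \<open>\<kappa>\<close> is nonzero iff \<open>\<bar>z\<^sub>1\<bar> = p\<^sup>\<gamma>\<close>, and another coefficient vanishes iff \<open>\<bar>z\<^sub>l\<bar> \<le> p\<^sup>\<gamma>\<close>, since
  there the a priori bound is \<open>p\<^sup>\<gamma>\<^sup>+\<^sup>1\<close>.  This describes the domain through its image under \<open>M\<close>, in
  terms that an isometry with known reductions can transport.
\<close>

lemma integration_domain_iff:
  "z \<in> integration_domain CARD('d) \<gamma> \<longleftrightarrow> z \<in> {1..CARD('d)} \<rightarrow>\<^sub>E UNIV \<and>
    vnorm (frame_map e z) \<le> real CARD('p) powi \<gamma> \<and>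
    (\<exists>c. c \<noteq> 0 \<and> vresidue (padic_p powi \<gamma> *s frame_map e z) = c *s \<kappa>)"
    (is "_ \<longleftrightarrow> ?E \<and> ?N \<and> ?R")
proof -
  define r where "r l = padic_residue (padic_p powi (\<gamma> + frame_weight l) * z l)" for l
  define u where "u l = vresidue (unit_vector l)" for l
  have u1: "u 1 = \<kappa>" unfolding u_def unit_vector_1 by (rule residue_first)
  have bounds: "?N \<longleftrightarrow> (\<forall>l\<in>{1..CARD('d)}. padic_abs (z l) \<le> real CARD('p) powi (\<gamma> + frame_weight l))"
    by (rule vnorm_frame_map_le_iff)
  have r0: "r l = 0 \<longleftrightarrow> padic_abs (z l) \<le> real CARD('p) powi (\<gamma> + frame_weight l - 1)"
    if ?N "l \<in> {1..CARD('d)}" for l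
  proof -
    have "padic_abs (padic_p powi (\<gamma> + frame_weight l) * z l) \<le> 1"
      using that bounds padic_abs_scale_le_iff[of "\<gamma> + frame_weight l" "z l" 0] by simp
    then show ?thesis unfolding r_def
      using padic_abs_scale_le_iff[of "\<gamma> + frame_weight l" "z l" "- 1"] by (simp add: padic_residue_eq_0_iff)
  qed
  have sum: "vresidue (padic_p powi \<gamma> *s frame_map e z) = (\<Sum>l=1..CARD('d). r l *s u l)" if ?N
    unfolding r_def u_def using frame_map_residue(2)[of z \<gamma>] that bounds by blast
  have R: "?R \<longleftrightarrow> r 1 \<noteq> 0 \<and> (\<forall>l\<in>{2..CARD('d)}. r l = 0)" if N: ?N
  proof
    assume ?R
    then obtain c where c: "c \<noteq> 0" "(\<Sum>l=1..CARD('d). r l *s u l) = c *s u 1"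
      unfolding sum[OF N] u1 by blast
    have "(\<Sum>l=1..CARD('d). (if l = 1 then c else 0) *s u l) = (\<Sum>l=1..CARD('d). if l = 1 then c *s u l else 0)"
      by (rule sum.cong) auto
    also have "\<dots> = c *s u 1" using one_in_indices by (subst sum.delta) auto
    finally have "(\<Sum>l=1..CARD('d). (r l - (if l = 1 then c else 0)) *s u l) = 0"
      using c(2) by (simp only: vector_sub_rdistrib sum_subtractf) simp
    then have "r l - (if l = 1 then c else 0) = 0" if "l \<in> {1..CARD('d)}" for l
      using spanning_family_independent[OF span_unit_vectors[folded u_def],
        of "\<lambda>l. r l - (if l = 1 then c else 0)", OF _ that] by blast
    from this[OF one_in_indices] this show "r 1 \<noteq> 0 \<and> (\<forall>l\<in>{2..CARD('d)}. r l = 0)"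
      using c(1) by fastforce
  next
    assume r: "r 1 \<noteq> 0 \<and> (\<forall>l\<in>{2..CARD('d)}. r l = 0)"
    have "(\<Sum>l=1..CARD('d). r l *s u l) = (\<Sum>l=1..CARD('d). if l = 1 then r l *s u l else 0)"
      using r by (intro sum.cong) auto
    also have "\<dots> = r 1 *s u 1" using one_in_indices by (subst sum.delta) auto
    finally show ?R unfolding sum[OF N] using r u1 by auto
  qed
  have D: "z \<in> integration_domain CARD('d) \<gamma> \<longleftrightarrow> ?E \<and> padic_abs (z 1) = real CARD('p) powi \<gamma> \<and>
      (\<forall>l\<in>{2..CARD('d)}. padic_abs (z l) \<le> real CARD('p) powi \<gamma>)"
    by (auto simp: integration_domain_def)
  have abs1: "padic_abs (z 1) = real CARD('p) powi \<gamma> \<longleftrightarrow> padic_abs (z 1) \<le> real CARD('p) powi \<gamma> \<and>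
      \<not> padic_abs (z 1) \<le> real CARD('p) powi (\<gamma> - 1)"
    using padic_abs_less_iff[of "z 1" \<gamma>] by auto
  have N: ?N if "z \<in> integration_domain CARD('d) \<gamma>"
    unfolding bounds
  proof
    fix l assume l: "l \<in> {1..CARD('d)}"
    then have "padic_abs (z l) \<le> real CARD('p) powi \<gamma>" using that unfolding D by (cases "l = 1") auto
    also have "\<dots> \<le> real CARD('p) powi (\<gamma> + frame_weight l)"
      by (simp add: padic_powi_le_cancel frame_weight_def)
    finally show "padic_abs (z l) \<le> real CARD('p) powi (\<gamma> + frame_weight l)" .
  qed
  have main: "padic_abs (z 1) = real CARD('p) powi \<gamma> \<and>
      (\<forall>l\<in>{2..CARD('d)}. padic_abs (z l) \<le> real CARD('p) powi \<gamma>) \<longleftrightarrow> ?R" if ?N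
  proof -
    have "padic_abs (z 1) \<le> real CARD('p) powi \<gamma>"
      using that one_in_indices unfolding bounds by (force simp: frame_weight_def)
    moreover have "r 1 = 0 \<longleftrightarrow> padic_abs (z 1) \<le> real CARD('p) powi (\<gamma> - 1)"
      using r0[OF that one_in_indices] by (simp add: frame_weight_def)
    moreover have "r l = 0 \<longleftrightarrow> padic_abs (z l) \<le> real CARD('p) powi \<gamma>" if "l \<in> {2..CARD('d)}" for l
      using r0[OF \<open>?N\<close>, of l] that by (simp add: frame_weight_def)
    ultimately show ?thesis unfolding R[OF that] abs1 by blast
  qed
  show ?thesis using N D main by blast
qed

end

section \<open>Tangent maps of isometries\<close>

lemma pball_center: "x \<in> pball x \<gamma>"
  using padic_card_gt_1 by (auto simp: pball_def)

lemma bij_isometry_image_pball: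
  assumes "bij_isometry \<phi>"
  shows "\<phi> ` pball x \<gamma> = pball (\<phi> x) \<gamma>"
proof -
  have "bij \<phi>" and iso: "\<And>x y. vnorm (\<phi> x - \<phi> y) = vnorm (x - y)"
    using assms by (auto simp: bij_isometry_def)
  then have "surj \<phi>" by (simp add: bij_is_surj)
  show ?thesis
  proof
    show "pball (\<phi> x) \<gamma> \<subseteq> \<phi> ` pball x \<gamma>"
    proof
      fix y assume y: "y \<in> pball (\<phi> x) \<gamma>"
      obtain u where "y = \<phi> u" using \<open>surj \<phi>\<close> by (rule surjE)
      then show "y \<in> \<phi> ` pball x \<gamma>" using y by (auto simp: pball_def iso)
    qed
  qed (auto simp: pball_def iso)
qed

text \<open>
  A ball of radius \<open>p\<^sup>\<delta>\<close> contains two points at distance exactly \<open>p\<^sup>\<delta>\<close>, so a ball determines its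
  exponent.
\<close>

lemma pball_exponent_le:
  assumes "pball a \<gamma> = pball b \<delta>"
  shows "\<delta> \<le> \<gamma>"
proof -
  define y :: "'a padic ^ 'b" where "y = (\<chi> l. padic_p powi - \<delta>)"
  have y: "vnorm y \<le> real CARD('a) powi n \<longleftrightarrow> \<delta> \<le> n" for n
    by (simp add: vnorm_le_iff y_def padic_powi_le_cancel)
  have "b \<in> pball a \<gamma>" "b + y \<in> pball a \<gamma>"
    using y[of \<delta>] pball_center[of b \<delta>] unfolding assms by (simp_all add: pball_def)
  then have "vnorm ((b + y - a) - (b - a)) \<le> real CARD('a) powi \<gamma>"
    unfolding pball_def by (intro vnorm_diff_le[of "_ - a"]) auto
  then show ?thesis using y by simp
qed

lemma ball_exponent_pball [simp]: "ball_exponent (pball a \<gamma>) = \<gamma>"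
  unfolding ball_exponent_def
proof (rule the_equality)
  fix \<delta> assume "\<exists>b. pball a \<gamma> = pball b \<delta>"
  then obtain b where b: "pball a \<gamma> = pball b \<delta>" by blast
  show "\<delta> = \<gamma>" using pball_exponent_le[OF b] pball_exponent_le[OF b[symmetric]] by simp
qed blast

lemma pball_in_balls: "pball x \<gamma> \<in> balls"
  by (auto simp: balls_def)

lemma vnorm_diff_pball:
  assumes "u \<in> pball x \<gamma>" "v \<in> pball x \<gamma>"
  shows "vnorm (padic_p powi \<gamma> *s (u - v)) \<le> 1"
proof -
  have "vnorm ((u - x) - (v - x)) \<le> real CARD('a) powi \<gamma>"
    using assms unfolding pball_def by (intro vnorm_diff_le[of "_ - x"]) auto
  then show ?thesis using vnorm_scale_le_iff[of \<gamma> "u - v" 0] by simp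
qed

lemma base_point_in_pball: "base_point (pball x \<gamma>) \<in> pball x \<gamma>"
  unfolding base_point_def using pball_center by (rule someI)

lemma ball_coord_diff:
  assumes "u \<in> pball x \<gamma>" "v \<in> pball x \<gamma>"
  shows "ball_coord (pball x \<gamma>) u - ball_coord (pball x \<gamma>) v = vresidue (padic_p powi \<gamma> *s (u - v))"
proof -
  let ?b = "base_point (pball x \<gamma>)"
  have "padic_p powi \<gamma> *s (u - v) = padic_p powi \<gamma> *s (u - ?b) - padic_p powi \<gamma> *s (v - ?b)"
    by (simp add: vec.scale_right_diff_distrib)
  then show ?thesis unfolding ball_coord_def ball_exponent_pball
    using assms base_point_in_pball by (metis vresidue_diff vnorm_diff_pball)
qed

text \<open>
  Points of \<open>B\<close> with equal coordinates lie in one maximal proper subball, and an isometry maps them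
  into one maximal proper subball again, so the point chosen by \<^const>\<open>inv_into\<close> does not matter.
\<close>

lemma tangent_map_ball_coord:
  assumes \<phi>: "bij_isometry \<phi>" and u: "u \<in> pball x \<gamma>"
  shows "tangent_map \<phi> (pball x \<gamma>) (ball_coord (pball x \<gamma>) u) = ball_coord (pball (\<phi> x) \<gamma>) (\<phi> u)"
proof -
  let ?B = "pball x \<gamma>" and ?C = "pball (\<phi> x) \<gamma>"
  define v where "v = inv_into ?B (ball_coord ?B) (ball_coord ?B u)"
  have im: "\<phi> ` ?B = ?C" by (rule bij_isometry_image_pball[OF \<phi>])
  have v: "v \<in> ?B" "ball_coord ?B v = ball_coord ?B u"
    unfolding v_def using u by (auto intro: inv_into_into f_inv_into_f)
  have C: "\<phi> u \<in> ?C" "\<phi> v \<in> ?C" using u v(1) im by blast+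
  have "vresidue (padic_p powi \<gamma> *s (v - u)) = 0"
    using ball_coord_diff[OF v(1) u] v(2) by simp
  then have "vnorm (padic_p powi \<gamma> *s (v - u)) \<le> real CARD('a) powi - 1"
    using vresidue_eq_0_iff[OF vnorm_diff_pball[OF v(1) u]] by blast
  then have "vnorm (v - u) \<le> real CARD('a) powi (\<gamma> - 1)" unfolding vnorm_scale_le_iff by simp
  then have "vnorm (\<phi> v - \<phi> u) \<le> real CARD('a) powi (\<gamma> - 1)"
    using \<phi> by (simp add: bij_isometry_def)
  then have "vnorm (padic_p powi \<gamma> *s (\<phi> v - \<phi> u)) \<le> real CARD('a) powi - 1"
    unfolding vnorm_scale_le_iff by simp
  then have "vresidue (padic_p powi \<gamma> *s (\<phi> v - \<phi> u)) = 0"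
    using vresidue_eq_0_iff[OF vnorm_diff_pball[OF C(2,1)]] by blast
  then have "ball_coord ?C (\<phi> v) = ball_coord ?C (\<phi> u)" using ball_coord_diff[OF C(2,1)] by simp
  then show ?thesis by (simp add: tangent_map_def im v_def)
qed

lemma is_linear_part_unique:
  assumes "is_linear_part A g" "is_linear_part A' g"
  shows "A = A'"
proof -
  obtain b where b: "\<And>v. g v = A *v v + b" using assms(1) by (auto simp: is_linear_part_def)
  obtain b' where b': "\<And>v. g v = A' *v v + b'" using assms(2) by (auto simp: is_linear_part_def)
  have "b = b'" using b[of 0] b'[of 0] by simp
  then have "A *v v = A' *v v" for v using b[of v] b'[of v] by simp
  then show ?thesis by (simp add: matrix_eq)
qed

lemma is_linear_part_tangent_linear_part:
  assumes "mod_p_affine_isometry \<phi>" "B \<in> balls"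
  shows "is_linear_part (tangent_linear_part \<phi> B) (tangent_map \<phi> B)"
proof -
  obtain A where A: "is_linear_part A (tangent_map \<phi> B)"
    using assms by (auto simp: mod_p_affine_isometry_def)
  then show ?thesis unfolding tangent_linear_part_def
    by (rule theI) (rule is_linear_part_unique[OF _ A])
qed

text \<open>
  Taking a difference of two values cancels the translation part of the affine tangent map and the
  base points of the coordinate maps.
\<close>

lemma mod_p_affine_isometry_increment:
  assumes \<phi>: "mod_p_affine_isometry \<phi>" and y: "vnorm y \<le> real CARD('p) powi \<gamma>"
  shows "vresidue (padic_p powi \<gamma> *s (\<phi> (x + y) - \<phi> x)) =
    tangent_linear_part \<phi> (pball x \<gamma>) *v vresidue (padic_p powi \<gamma> *s (y :: 'p::prime_card padic ^ 'd))"
proof -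
  let ?B = "pball x \<gamma>" and ?C = "pball (\<phi> x) \<gamma>" and ?A = "tangent_linear_part \<phi> (pball x \<gamma>)"
  have iso: "bij_isometry \<phi>" using \<phi> by (simp add: mod_p_affine_isometry_def)
  have B: "x + y \<in> ?B" "x \<in> ?B" using y by (simp_all add: pball_center) (simp add: pball_def)
  then have C: "\<phi> (x + y) \<in> ?C" "\<phi> x \<in> ?C"
    using bij_isometry_image_pball[OF iso] by blast+
  obtain b where b: "\<And>v. tangent_map \<phi> ?B v = ?A *v v + b"
    using is_linear_part_tangent_linear_part[OF \<phi> pball_in_balls[of x \<gamma>]]
    by (auto simp: is_linear_part_def)
  have "vresidue (padic_p powi \<gamma> *s (\<phi> (x + y) - \<phi> x)) = ball_coord ?C (\<phi> (x + y)) - ball_coord ?C (\<phi> x)"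
    by (rule ball_coord_diff[OF C, symmetric])
  also have "\<dots> = tangent_map \<phi> ?B (ball_coord ?B (x + y)) - tangent_map \<phi> ?B (ball_coord ?B x)"
    by (simp only: tangent_map_ball_coord[OF iso] B)
  also have "\<dots> = ?A *v (ball_coord ?B (x + y) - ball_coord ?B x)"
    by (simp add: b matrix_vector_mult_diff_distrib)
  also have "\<dots> = ?A *v vresidue (padic_p powi \<gamma> *s y)"
    by (simp add: ball_coord_diff[OF B])
  finally show ?thesis .
qed

lemma invertible_matrix_inv:
  assumes "invertible A"
  shows "A ** matrix_inv A = mat 1" "matrix_inv A ** A = mat 1"
proof -
  have "\<exists>B. A ** B = mat 1 \<and> B ** A = mat 1" using assms by (simp add: invertible_def)
  then have "A ** matrix_inv A = mat 1 \<and> matrix_inv A ** A = mat 1"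
    unfolding matrix_inv_def by (rule someI_ex)
  then show "A ** matrix_inv A = mat 1" "matrix_inv A ** A = mat 1" by auto
qed

text \<open>
  The direction attached to \<open>B\<close> is by definition the one that the linear part \<open>A\<close> carries to the
  direction attached to \<open>\<phi> ` B\<close>, so even the scalar \<open>c\<close> survives the transport.
\<close>

lemma residue_direction_iff:
  assumes \<phi>: "mod_p_affine_isometry \<phi>" and y: "vnorm y \<le> real CARD('p) powi \<gamma>"
  shows "vresidue (padic_p powi \<gamma> *s (\<phi> (x + y) - \<phi> x)) = c *s v \<longleftrightarrow>
    vresidue (padic_p powi \<gamma> *s (y :: 'p::prime_card padic ^ 'd)) =
      c *s (matrix_inv (tangent_linear_part \<phi> (pball x \<gamma>)) *v v)"
proof -
  define A where "A = tangent_linear_part \<phi> (pball x \<gamma>)"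
  have "invertible A"
    using is_linear_part_tangent_linear_part[OF \<phi> pball_in_balls[of x \<gamma>]]
    by (simp add: is_linear_part_def A_def)
  note inv = invertible_matrix_inv[OF this]
  have "A *v r = c *s v \<longleftrightarrow> r = c *s (matrix_inv A *v v)" for r
  proof
    assume "A *v r = c *s v"
    then have "matrix_inv A *v (A *v r) = matrix_inv A *v (c *s v)" by simp
    then show "r = c *s (matrix_inv A *v v)"
      by (simp add: matrix_vector_mul_assoc inv vector_scalar_commute)
  next
    assume "r = c *s (matrix_inv A *v v)"
    then show "A *v r = c *s v"
      by (simp add: vector_scalar_commute[symmetric] matrix_vector_mul_assoc inv)
  qed
  then show ?thesis using mod_p_affine_isometry_increment[OF \<phi> y] by (simp add: A_def)
qed

section \<open>Transport of the integrals\<close>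

text \<open>
  The substitution \<open>T\<close> described at the top, for a fixed radius.
\<close>

lemma pd_integral_transport:
  fixes \<phi> :: "'p::prime_card padic ^ 'd \<Rightarrow> 'p padic ^ 'd"
  assumes \<mu>: "haar_measure \<mu>" and \<phi>: "mod_p_affine_isometry \<phi>"
    and K: "adapted_frame k K"
    and K': "adapted_frame (\<lambda>B. matrix_inv (tangent_linear_part \<phi> B) *v k (\<phi> ` B)) K'"
    and int: "set_integrable (product_haar \<mu> CARD('d)) (integration_domain CARD('d) \<gamma>)
      (pd_integrand F K f (\<phi> x) \<gamma>)"
  shows "pd_integral \<mu> F K f (\<phi> x) \<gamma> = pd_integral \<mu> (\<lambda>B. F (\<phi> ` B)) K' (f \<circ> \<phi>) x \<gamma>"
proof -
  let ?B = "pball x \<gamma>" and ?C = "pball (\<phi> x) \<gamma>" and ?I = "{1..CARD('d)}"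
  let ?D = "integration_domain CARD('d) \<gamma> :: (nat \<Rightarrow> 'p padic) set"
  let ?\<Omega> = "?I \<rightarrow>\<^sub>E (UNIV :: 'p padic set)" and ?P = "\<Pi>\<^sub>M i\<in>?I. \<mu>"
  have bij: "bij_isometry \<phi>" using \<phi> by (simp add: mod_p_affine_isometry_def)
  have iso: "vnorm (\<phi> u - \<phi> v) = vnorm (u - v)" for u v using bij by (simp add: bij_isometry_def)
  have im: "\<phi> ` ?B = ?C" by (rule bij_isometry_image_pball[OF bij])
  interpret M: padic_frame "k ?C" "K ?C"
    using K pball_in_balls by (auto simp: adapted_frame_iff)
  interpret M': padic_frame "matrix_inv (tangent_linear_part \<phi> ?B) *v k ?C" "K' ?B"
    using K' pball_in_balls[of x \<gamma>] im by (force simp: adapted_frame_iff)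
  let ?M = "frame_map (K ?C)" and ?M' = "frame_map (K' ?B)"
  define T where "T z = inv_into ?\<Omega> ?M (\<phi> (x + ?M' z) - \<phi> x)" for z
  have surjM: "v \<in> ?M ` ?\<Omega>" for v using M.frame_map_bij by (simp add: bij_betw_def)
  have T\<Omega>: "T z \<in> ?\<Omega>" for z unfolding T_def using surjM by (rule inv_into_into)
  have MT: "?M (T z) = \<phi> (x + ?M' z) - \<phi> x" for z
    unfolding T_def using surjM by (rule f_inv_into_f)
  have surj: "T ` ?\<Omega> = ?\<Omega>"
  proof
    show "?\<Omega> \<subseteq> T ` ?\<Omega>"
    proof
      fix y assume y: "y \<in> ?\<Omega>"
      have "surj \<phi>" using bij by (simp add: bij_isometry_def bij_is_surj)
      then obtain u where u: "?M y + \<phi> x = \<phi> u" by (rule surjE)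
      have "u - x \<in> ?M' ` ?\<Omega>" using M'.frame_map_bij by (simp add: bij_betw_def)
      then obtain z where z: "u - x = ?M' z" "z \<in> ?\<Omega>" by (rule imageE)
      have "?M (T z) = ?M y" using u by (simp add: MT flip: z(1)) (simp flip: u)
      then have "T z = y"
        using M.frame_map_bij T\<Omega>[of z] y by (auto simp: bij_betw_def dest: inj_onD)
      then show "y \<in> T ` ?\<Omega>" using z(2) by blast
    qed
  qed (use T\<Omega> in blast)
  \<comment> \<open>Both frames induce the same weighted norm, which makes \<open>T\<close> an isometry for it.\<close>
  have ball_iff: "z \<in> weighted_ball ?I frame_weight z' \<delta> \<longleftrightarrow>
      vnorm (frame_map e z - frame_map e z') \<le> real CARD('p) powi \<delta>"
    if "padic_frame \<kappa> e" "z \<in> ?\<Omega>" for \<kappa> :: "'p mod_ring ^ 'd" and e z z' \<delta>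
    using padic_frame.vnorm_frame_map_le_iff[OF that(1), of "\<lambda>l. z l - z' l" \<delta>] that(2)
    by (simp add: weighted_ball_iff frame_map_diff)
  have T_iso: "T z \<in> weighted_ball ?I frame_weight (T z') \<delta> \<longleftrightarrow> z \<in> weighted_ball ?I frame_weight z' \<delta>"
    if "z \<in> ?\<Omega>" "z' \<in> ?\<Omega>" for z z' \<delta>
  proof -
    have "?M (T z) - ?M (T z') = \<phi> (x + ?M' z) - \<phi> (x + ?M' z')" by (simp add: MT)
    then have "vnorm (?M (T z) - ?M (T z')) = vnorm (?M' z - ?M' z')" by (simp add: iso)
    then show ?thesis
      using ball_iff[OF M.padic_frame_axioms T\<Omega>] ball_iff[OF M'.padic_frame_axioms that(1)] by simp
  qed
  have T_dom: "T z \<in> ?D \<longleftrightarrow> z \<in> ?D" if "z \<in> ?\<Omega>" for z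
  proof -
    have "vnorm (?M (T z)) = vnorm (?M' z)" unfolding MT using iso[of "x + ?M' z" x] by simp
    moreover have "vresidue (padic_p powi \<gamma> *s ?M (T z)) = c *s k ?C \<longleftrightarrow>
        vresidue (padic_p powi \<gamma> *s ?M' z) = c *s (matrix_inv (tangent_linear_part \<phi> ?B) *v k ?C)"
      if "vnorm (?M' z) \<le> real CARD('p) powi \<gamma>" for c
      unfolding MT by (rule residue_direction_iff[OF \<phi> that])
    ultimately show ?thesis
      using M.integration_domain_iff[of "T z" \<gamma>] M'.integration_domain_iff[of z \<gamma>] T\<Omega> that by auto
  qed
  define g where "g z = indicator ?D z *\<^sub>R pd_integrand F K f (\<phi> x) \<gamma> z" for z
  have P: "product_haar \<mu> CARD('d) = ?P" by (simp add: product_haar_def)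
  have space: "space ?P = ?\<Omega>"
    using \<mu> sets_eq_imp_space_eq[of \<mu> borel] by (simp add: space_PiM haar_measure_def)
  have g: "g \<in> borel_measurable ?P"
    using int unfolding set_integrable_def P g_def[symmetric] by (rule borel_measurable_integrable)
  note T_meas = distr_PiM_haar_isometry[OF \<mu> finite_atLeastAtMost surj T_iso]
  have "pd_integral \<mu> F K f (\<phi> x) \<gamma> = integral\<^sup>L ?P g"
    unfolding pd_integral_def set_lebesgue_integral_def P g_def[abs_def] ..
  also have "\<dots> = integral\<^sup>L (distr ?P ?P T) g" by (subst T_meas(2)) simp_all
  also have "\<dots> = integral\<^sup>L ?P (\<lambda>z. g (T z))" using T_meas(1) g by (intro integral_distr) auto
  also have "\<dots> = integral\<^sup>L ?P (\<lambda>z. indicator ?D z *\<^sub>R pd_integrand (\<lambda>B. F (\<phi> ` B)) K' (f \<circ> \<phi>) x \<gamma> z)"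
  proof (rule Bochner_Integration.integral_cong)
    fix z assume "z \<in> space ?P"
    then have "indicator ?D (T z) = (indicator ?D z :: real)"
      using T_dom space by (simp add: indicator_def)
    then show "g (T z) = indicator ?D z *\<^sub>R pd_integrand (\<lambda>B. F (\<phi> ` B)) K' (f \<circ> \<phi>) x \<gamma> z"
      using MT[of z] unfolding g_def pd_integrand_def im by (simp add: frame_map_def)
  qed simp
  also have "\<dots> = pd_integral \<mu> (\<lambda>B. F (\<phi> ` B)) K' (f \<circ> \<phi>) x \<gamma>"
    by (simp add: pd_integral_def set_lebesgue_integral_def P)
  finally show ?thesis .
qed

theorem theorem18:
  fixes \<phi> :: "'p::prime_card padic ^ 'd \<Rightarrow> 'p padic ^ 'd"
    and \<mu> :: "'p padic measure"
    and F :: "('p padic ^ 'd) set \<Rightarrow> complex"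
    and k :: "('p padic ^ 'd) set \<Rightarrow> 'p mod_ring ^ 'd"
    and K K' :: "('p padic ^ 'd) set \<Rightarrow> nat \<Rightarrow> 'p padic ^ 'd"
    and f :: "'p padic ^ 'd \<Rightarrow> complex"
    and x :: "'p padic ^ 'd"
  assumes "haar_measure \<mu>"
    and "mod_p_affine_isometry \<phi>"
    and "\<forall>B\<in>balls. k B \<noteq> 0"
    and "adapted_frame k K"
    and "adapted_frame (\<lambda>B. matrix_inv (tangent_linear_part \<phi> B) *v k (\<phi> ` B)) K'"
    and "pd_converges \<mu> F K f (\<phi> x)"
    and "pd_converges \<mu> (\<lambda>B. F (\<phi> ` B)) K' (f \<circ> \<phi>) x"
  shows "(pd_vector_field \<mu> F K f \<circ> \<phi>) x
    = pd_vector_field \<mu> (\<lambda>B. F (\<phi> ` B)) K' (f \<circ> \<phi>) x"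
proof -
  have "pd_integral \<mu> F K f (\<phi> x) \<gamma> = pd_integral \<mu> (\<lambda>B. F (\<phi> ` B)) K' (f \<circ> \<phi>) x \<gamma>" for \<gamma>
    using assms by (intro pd_integral_transport) (auto simp: pd_converges_def)
  then show ?thesis by (simp add: pd_vector_field_def)
qed

end
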